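(* Let $G\le M\le K_1,\ldots,K_r$ be groups such that $K_i\cap K_j=M$ for any distinct indices $i,j\in\{1,\ldots,r\}$, let $L_i$ be a subgroup of $K_i$, and let $A_i=G\cap L_i$, for each $i=1,\ldots,r$. Then in the $\ast$-construction $\mathop{\circledast}_{i=1}^{r}(K_i,L_i,t_i)_M$ we have $$\langle G,t_1,\ldots,t_r\rangle=G*_{A_1,\ldots,A_r}(t_1,\ldots,t_r).$$
   Context: Notation: $x^y=y^{-1}xy$. For $L\le K$, $K*_L t$ denotes the HNN-extension $\langle K,t\mid a^t=a\text{ for all }a\in L\rangle$; for groups $P,Q$ with a common subgroup $M$, $P*_M Q$ is their free product with amalgamated subgroup $M$ (via the identity map of $M$). For subgroups $A_1,\ldots,A_r\le G$, $G*_{A_1,\ldots,A_r}(t_1,\ldots,t_r)$ denotes the multiple HNN-extension $\langle G,t_1,\ldots,t_r\mid a^{t_i}=a\text{ for all }a\in A_i,\ i=1,\ldots,r\rangle$. The $\ast$-construction: given groups $M\le K_1,\ldots,K_r$ with $K_i\cap K_j=M$ for $i\ne j$ and subgroups $L_i\le K_i$, the group $\mathop{\circledast}_{i=1}^{r}(K_i,L_i,t_i)_M$ is $$\Big(\cdots\Big(\big((K_1*_{L_1}t_1)*_M(K_2*_{L_2}t_2)\big)*_M(K_3*_{L_3}t_3)\Big)\cdots\Big)*_M(K_r*_{L_r}t_r),$$ i.e. the HNN-extensions $K_i*_{L_i}t_i$ (with distinct stable letters $t_1,\ldots,t_r$) are all amalgamated in their common subgroup $M$. The groups $G$, $M$,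 $K_i$ are identified with their natural images in it. The equality in the claim means that the natural homomorphism from the HNN-extension $G*_{A_1,\ldots,A_r}(t_1,\ldots,t_r)$ to the $\ast$-construction (inclusion on $G$, $t_i\mapsto t_i$) is injective with image $\langle G,t_1,\ldots,t_r\rangle$. *)

theory Defs
  imports "HOL-Algebra.Generated_Groups" "HOL-Algebra.Weak_Morphisms"
begin

text \<open>
  Words in the letters \<open>x\<close> and \<open>x\<inverse>\<close>, written \<open>(True, x)\<close> and \<open>(False, x)\<close>. Elements of the
  presented group \<open>\<langle>X | u = v for (u, v) \<in> R\<rangle>\<close> are the classes of words over \<open>X\<close> under the least
  congruence that contains \<open>R\<close> and permits free cancellation.
\<close>

type_synonym 'x gword = "(bool \<times> 'x) list"

definition gwords :: "'x set \<Rightarrow> 'x gword set" where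
  "gwords X = lists (UNIV \<times> X)"

inductive pres_cong :: "'x set \<Rightarrow> ('x gword \<times> 'x gword) set \<Rightarrow> 'x gword \<Rightarrow> 'x gword \<Rightarrow> bool"
  for X :: "'x set" and R :: "('x gword \<times> 'x gword) set" where
  pres_refl: "w \<in> gwords X \<Longrightarrow> pres_cong X R w w"
| pres_sym: "pres_cong X R u v \<Longrightarrow> pres_cong X R v u"
| pres_trans: "pres_cong X R u v \<Longrightarrow> pres_cong X R v w \<Longrightarrow> pres_cong X R u w"
| pres_cancel: "p \<in> gwords X \<Longrightarrow> q \<in> gwords X \<Longrightarrow> x \<in> X \<Longrightarrow>
    pres_cong X R (p @ [(b, x), (\<not> b, x)] @ q) (p @ q)"
| pres_rel: "p \<in> gwords X \<Longrightarrow> q \<in> gwords X \<Longrightarrow> (u, v) \<in> R \<Longrightarrow> u \<in> gwords X \<Longrightarrow> v \<in> gwords X \<Longrightarrow>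
    pres_cong X R (p @ u @ q) (p @ v @ q)"

definition pres_class :: "'x set \<Rightarrow> ('x gword \<times> 'x gword) set \<Rightarrow> 'x gword \<Rightarrow> 'x gword set" where
  "pres_class X R w = {v. pres_cong X R w v}"

definition presented_group ::
    "'x set \<Rightarrow> ('x gword \<times> 'x gword) set \<Rightarrow> 'x gword set monoid" where
  "presented_group X R =
    \<lparr>carrier = pres_class X R ` gwords X,
     monoid.mult = (\<lambda>U V. \<Union>u\<in>U. \<Union>v\<in>V. pres_class X R (u @ v)),
     one = pres_class X R []\<rparr>"

definition table_rels :: "('p, 'c) monoid_scheme \<Rightarrow> ('p \<Rightarrow> 'x) \<Rightarrow> ('x gword \<times> 'x gword) set" where
  "table_rels P f =
    {([(True, f a), (True, f b)], [(True, f (a \<otimes>\<^bsub>P\<^esub> b))]) | a b. a \<in> carrier P \<and> b \<in> carrier P}"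

text \<open>
  The multiple HNN-extension of \<open>G\<close> with stable letters \<open>t\<^sub>i\<close> (\<open>i \<in> I\<close>), where \<open>t\<^sub>i\<close> is the generator
  \<open>Inr i\<close>, and relations \<open>t\<^sub>i\<inverse> a t\<^sub>i = a\<close> for \<open>a \<in> A i\<close>. An ordinary HNN-extension is the case
  \<open>I = {i}\<close>.
\<close>

definition hnn_gens :: "('a, 'c) monoid_scheme \<Rightarrow> 'i set \<Rightarrow> ('a + 'i) set" where
  "hnn_gens G I = Inl ` carrier G \<union> Inr ` I"

definition hnn_rels ::
    "('a, 'c) monoid_scheme \<Rightarrow> 'i set \<Rightarrow> ('i \<Rightarrow> 'a set) \<Rightarrow> (('a + 'i) gword \<times> ('a + 'i) gword) set" where
  "hnn_rels G I A = table_rels G Inl \<union>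
    {([(False, Inr i), (True, Inl a), (True, Inr i)], [(True, Inl a)]) | i a. i \<in> I \<and> a \<in> A i}"

definition hnn ::
    "('a, 'c) monoid_scheme \<Rightarrow> 'i set \<Rightarrow> ('i \<Rightarrow> 'a set) \<Rightarrow> ('a + 'i) gword set monoid" where
  "hnn G I A = presented_group (hnn_gens G I) (hnn_rels G I A)"

definition hnn_base ::
    "('a, 'c) monoid_scheme \<Rightarrow> 'i set \<Rightarrow> ('i \<Rightarrow> 'a set) \<Rightarrow> 'a \<Rightarrow> ('a + 'i) gword set" where
  "hnn_base G I A a = pres_class (hnn_gens G I) (hnn_rels G I A) [(True, Inl a)]"

definition hnn_stable ::
    "('a, 'c) monoid_scheme \<Rightarrow> 'i set \<Rightarrow> ('i \<Rightarrow> 'a set) \<Rightarrow> 'i \<Rightarrow> ('a + 'i) gword set" where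
  "hnn_stable G I A i = pres_class (hnn_gens G I) (hnn_rels G I A) [(True, Inr i)]"

text \<open>
  The free product of \<open>P\<close> and \<open>Q\<close> with amalgamated subgroup \<open>M\<close>, where \<open>f : M \<rightarrow> P\<close> and
  \<open>g : M \<rightarrow> Q\<close> are the embeddings along which \<open>M\<close> is regarded as a common subgroup.
\<close>

definition amalg_gens :: "('p, 'c) monoid_scheme \<Rightarrow> ('q, 'd) monoid_scheme \<Rightarrow> ('p + 'q) set" where
  "amalg_gens P Q = Inl ` carrier P \<union> Inr ` carrier Q"

definition amalg_rels ::
    "('p, 'c) monoid_scheme \<Rightarrow> ('q, 'd) monoid_scheme \<Rightarrow> 'm set \<Rightarrow> ('m \<Rightarrow> 'p) \<Rightarrow> ('m \<Rightarrow> 'q) \<Rightarrow>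
     (('p + 'q) gword \<times> ('p + 'q) gword) set" where
  "amalg_rels P Q M f g = table_rels P Inl \<union> table_rels Q Inr \<union>
    {([(True, Inl (f m))], [(True, Inr (g m))]) | m. m \<in> M}"

definition amalg ::
    "('p, 'c) monoid_scheme \<Rightarrow> ('q, 'd) monoid_scheme \<Rightarrow> 'm set \<Rightarrow> ('m \<Rightarrow> 'p) \<Rightarrow> ('m \<Rightarrow> 'q) \<Rightarrow>
     ('p + 'q) gword set monoid" where
  "amalg P Q M f g = presented_group (amalg_gens P Q) (amalg_rels P Q M f g)"

definition amalg_left ::
    "('p, 'c) monoid_scheme \<Rightarrow> ('q, 'd) monoid_scheme \<Rightarrow> 'm set \<Rightarrow> ('m \<Rightarrow> 'p) \<Rightarrow> ('m \<Rightarrow> 'q) \<Rightarrow>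
     'p \<Rightarrow> ('p + 'q) gword set" where
  "amalg_left P Q M f g a = pres_class (amalg_gens P Q) (amalg_rels P Q M f g) [(True, Inl a)]"

definition amalg_right ::
    "('p, 'c) monoid_scheme \<Rightarrow> ('q, 'd) monoid_scheme \<Rightarrow> 'm set \<Rightarrow> ('m \<Rightarrow> 'p) \<Rightarrow> ('m \<Rightarrow> 'q) \<Rightarrow>
     'q \<Rightarrow> ('p + 'q) gword set" where
  "amalg_right P Q M f g b = pres_class (amalg_gens P Q) (amalg_rels P Q M f g) [(True, Inr b)]"

text \<open>
  Each application of \<^const>\<open>amalg\<close> enlarges the element type. To iterate it a variable number of
  times, the groups \<open>S\<^sub>1 = H\<^sub>1\<close> and \<open>S\<^sub>n\<^sub>+\<^sub>1 = S\<^sub>n *\<^sub>M H\<^sub>n\<^sub>+\<^sub>1\<close> are transported along injections to the one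
  type \<open>'h amalg_elt\<close>: an element of an amalgamated product, which is a class of words, is coded by a
  chosen word in it.
\<close>

datatype 'h amalg_elt = Base 'h | Word "('h amalg_elt + 'h) gword"

definition amalg_code :: "('h amalg_elt + 'h) gword set \<Rightarrow> 'h amalg_elt" where
  "amalg_code C = Word (SOME w. w \<in> C)"

text \<open>
  \<open>iter_amalg H M \<iota> n\<close> consists of the group
  \<open>S\<^sub>n = (\<cdots>((H\<^sub>1 *\<^sub>M H\<^sub>2) *\<^sub>M H\<^sub>3)\<cdots>) *\<^sub>M H\<^sub>n\<close> and the natural maps \<open>\<phi> i : H\<^sub>i \<rightarrow> S\<^sub>n\<close> for \<open>1 \<le> i \<le> n\<close>, where
  \<open>\<iota> i : M \<rightarrow> H\<^sub>i\<close> are the given embeddings. In \<open>S\<^sub>n\<close> the subgroup \<open>M\<close> is the image of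
  \<open>\<phi> 1 \<circ> \<iota> 1\<close>, which equals \<open>\<phi> i \<circ> \<iota> i\<close> on \<open>M\<close> for all \<open>i\<close>. The value at \<open>n = 0\<close> is left unspecified.
\<close>

fun iter_amalg ::
    "(nat \<Rightarrow> 'h monoid) \<Rightarrow> 'm set \<Rightarrow> (nat \<Rightarrow> 'm \<Rightarrow> 'h) \<Rightarrow> nat \<Rightarrow>
     'h amalg_elt monoid \<times> (nat \<Rightarrow> 'h \<Rightarrow> 'h amalg_elt)" where
  "iter_amalg H M \<iota> (Suc 0) = (image_group Base (H 1), \<lambda>i. Base)"
| "iter_amalg H M \<iota> (Suc (Suc n)) =
    (let (P, \<phi>) = iter_amalg H M \<iota> (Suc n);
         k = Suc (Suc n); Q = H k; f = \<phi> 1 \<circ> \<iota> 1; g = \<iota> k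
     in (image_group amalg_code (amalg P Q M f g),
         \<lambda>i. if i = k then amalg_code \<circ> amalg_right P Q M f g
             else amalg_code \<circ> amalg_left P Q M f g \<circ> \<phi> i))"

text \<open>
  The \<open>\<circledast>\<close>-construction of the \<open>(K i, L i, t\<^sub>i)\<close>, \<open>i = 1, \<dots>, r\<close>, over \<open>M\<close>, with the natural images of
  the elements of \<open>M\<close> and of the stable letters.
\<close>

definition star_factor ::
    "(nat \<Rightarrow> 'a monoid) \<Rightarrow> (nat \<Rightarrow> 'a set) \<Rightarrow> nat \<Rightarrow> ('a + nat) gword set monoid" where
  "star_factor K L i = hnn (K i) {i} L"

definition star_system ::
    "(nat \<Rightarrow> 'a monoid) \<Rightarrow> (nat \<Rightarrow> 'a set) \<Rightarrow> 'a set \<Rightarrow> nat \<Rightarrow>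
     ('a + nat) gword set amalg_elt monoid \<times>
     (nat \<Rightarrow> ('a + nat) gword set \<Rightarrow> ('a + nat) gword set amalg_elt)" where
  "star_system K L M r = iter_amalg (star_factor K L) M (\<lambda>i. hnn_base (K i) {i} L) r"

definition star_group ::
    "(nat \<Rightarrow> 'a monoid) \<Rightarrow> (nat \<Rightarrow> 'a set) \<Rightarrow> 'a set \<Rightarrow> nat \<Rightarrow>
     ('a + nat) gword set amalg_elt monoid" where
  "star_group K L M r = fst (star_system K L M r)"

definition star_base ::
    "(nat \<Rightarrow> 'a monoid) \<Rightarrow> (nat \<Rightarrow> 'a set) \<Rightarrow> 'a set \<Rightarrow> nat \<Rightarrow> 'a \<Rightarrow>
     ('a + nat) gword set amalg_elt" where
  "star_base K L M r m = snd (star_system K L M r) 1 (hnn_base (K 1) {1} L m)"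

definition star_stable ::
    "(nat \<Rightarrow> 'a monoid) \<Rightarrow> (nat \<Rightarrow> 'a set) \<Rightarrow> 'a set \<Rightarrow> nat \<Rightarrow> nat \<Rightarrow>
     ('a + nat) gword set amalg_elt" where
  "star_stable K L M r i = snd (star_system K L M r) i (hnn_stable (K i) {i} L i)"

end

theory Submission
  imports Defs "HOL-Algebra.Bij"
begin

text \<open>
  Write \<open>E\<close> for the HNN-extension \<open>G *\<^bsub>A\<^sub>1,\<dots>,A\<^sub>r\<^esub> (t\<^sub>1, \<dots>, t\<^sub>r)\<close> and \<open>S\<close> for the \<open>\<circledast>\<close>-construction.
  The natural map \<open>\<phi> : E \<rightarrow> S\<close> exists by the universal property of \<open>E\<close>, because \<open>t\<^sub>i\<close> commutes in \<open>S\<close>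
  with \<open>L\<^sub>i \<supseteq> A\<^sub>i\<close>, and its image is generated by the images of the generators of \<open>E\<close>. The content of
  the theorem is that \<open>\<phi>\<close> is injective. The reason is that the left regular representation of \<open>E\<close>
  extends, along \<open>\<phi>\<close>, to a permutation representation of \<open>S\<close> on a larger set \<open>\<Omega>\<close>.

  By the universal properties of the factors \<open>K\<^sub>i *\<^bsub>L\<^sub>i\<^esub> t\<^sub>i\<close> and of the iterated amalgam
  (\<open>hnn_hom\<close>, \<open>iter_amalg_hom\<close>), such a representation consists of actions of the \<open>K\<^sub>i\<close> on \<open>\<Omega>\<close> that agree
  on \<open>M\<close>, and of permutations \<open>T\<^sub>i\<close> of \<open>\<Omega>\<close> that commute with \<open>L\<^sub>i\<close>. They arise in two steps.

  \<^item> Let \<open>C\<^sub>i\<close> be a transversal of the cosets \<open>M k\<close> in \<open>K\<^sub>i\<close> and \<open>W = M \<times> C\<^sub>1 \<times> \<cdots> \<times> C\<^sub>r\<close>. As \<open>M \<times> C\<^sub>i\<close>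
    is \<open>K\<^sub>i\<close>, the group \<open>K\<^sub>i\<close> acts on \<open>W\<close> by left multiplication on the coordinates \<open>M\<close> and \<open>C\<^sub>i\<close>. These
    actions agree on \<open>M\<close>, and \<open>\<kappa>\<^sub>i(m, c) = m c\<^sub>i\<close> is an equivariant map \<open>W \<rightarrow> K\<^sub>i\<close> (\<open>common_action\<close>).

  \<^item> Let \<open>\<Omega> = W \<times> E\<close>, where \<open>K\<^sub>i\<close> acts on the first coordinate and \<open>T\<^sub>i\<close> multiplies the second coordinate
    over \<open>w\<close> by \<open>\<tau>\<^sub>i(\<kappa>\<^sub>i(w))\<close>, with \<open>\<tau>\<^sub>i(l g) = g\<inverse> t\<^sub>i g\<close> for \<open>l \<in> L\<^sub>i\<close>, \<open>g \<in> G\<close>, and \<open>\<tau>\<^sub>i = 1\<close> outside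
    \<open>L\<^sub>i G\<close>. Two factorisations of an element of \<open>L\<^sub>i G\<close> differ by an element of \<open>L\<^sub>i \<inter> G = A\<^sub>i\<close>, which
    commutes with \<open>t\<^sub>i\<close>, so \<open>\<tau>\<^sub>i\<close> is well defined. It is invariant under \<open>L\<^sub>i\<close> from the left, so \<open>T\<^sub>i\<close>
    commutes with \<open>L\<^sub>i\<close>.

  To find \<open>E\<close> inside \<open>\<Omega>\<close>, let \<open>\<rho> : E \<rightarrow> G\<close> be the retraction that kills all \<open>t\<^sub>i\<close>, let \<open>w\<^sub>0\<close> be the base
  point of \<open>W\<close>, and put \<open>u(x) = (\<rho>(x) w\<^sub>0, \<rho>(x)\<inverse> x)\<close>. Then \<open>g u(x) = u(g x)\<close> and, since
  \<open>\<tau>\<^sub>i(\<rho>(x)) = \<rho>(x)\<inverse> t\<^sub>i \<rho>(x)\<close>, also \<open>T\<^sub>i u(x) = u(t\<^sub>i x)\<close> (\<open>extension_to_permutations\<close>). Hence every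
  \<open>y \<in> E\<close> acts through \<open>\<phi>(y)\<close> on \<open>u(E)\<close> as left translation by \<open>y\<close>. As \<open>u\<close> is injective, \<open>\<phi>(y)\<close>
  determines \<open>y\<close>.
\<close>

section \<open>Groups given by a presentation\<close>

lemma gwords_append [simp]: "u @ v \<in> gwords X \<longleftrightarrow> u \<in> gwords X \<and> v \<in> gwords X"
  by (auto simp: gwords_def)

lemma gwords_Nil [simp]: "[] \<in> gwords X"
  by (simp add: gwords_def)

lemma gwords_Cons [simp]: "(b, x) # w \<in> gwords X \<longleftrightarrow> x \<in> X \<and> w \<in> gwords X"
  by (auto simp: gwords_def)

lemma pres_cong_gwords:
  "pres_cong X R u v \<Longrightarrow> u \<in> gwords X \<and> v \<in> gwords X"
  by (induction rule: pres_cong.induct) auto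

lemma pres_cong_context:
  "pres_cong X R u v \<Longrightarrow> p \<in> gwords X \<Longrightarrow> q \<in> gwords X \<Longrightarrow> pres_cong X R (p @ u @ q) (p @ v @ q)"
proof (induction rule: pres_cong.induct)
  case (pres_refl w)
  then show ?case by (intro pres_cong.pres_refl) auto
next
  case (pres_sym u v)
  then show ?case by (blast intro: pres_cong.pres_sym)
next
  case (pres_trans u v w)
  then show ?case by (blast intro: pres_cong.pres_trans)
next
  case (pres_cancel p' q' x b)
  then show ?case
    using pres_cong.pres_cancel[of "p @ p'" X "q' @ q" x R b] by simp
next
  case (pres_rel p' q' u v)
  then show ?case
    using pres_cong.pres_rel[of "p @ p'" X "q' @ q" u v R] by simp
qed

lemma pres_cong_append:
  assumes "pres_cong X R u u'" "pres_cong X R v v'"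
  shows "pres_cong X R (u @ v) (u' @ v')"
proof -
  note gw = pres_cong_gwords[OF assms(1)] pres_cong_gwords[OF assms(2)]
  have "pres_cong X R (u @ v) (u' @ v)"
    using pres_cong_context[OF assms(1), of "[]" v] gw by simp
  also have "pres_cong X R (u' @ v) (u' @ v')"
    using pres_cong_context[OF assms(2), of u' "[]"] gw by simp
  finally (pres_trans) show ?thesis .
qed

lemma pres_class_eq_iff:
  assumes "u \<in> gwords X"
  shows "pres_class X R u = pres_class X R v \<longleftrightarrow> pres_cong X R u v"
proof
  assume "pres_class X R u = pres_class X R v"
  then have "u \<in> pres_class X R v"
    using pres_refl[OF assms, of R] by (auto simp: pres_class_def)
  then show "pres_cong X R u v"
    by (simp add: pres_class_def pres_sym)
next
  assume uv: "pres_cong X R u v"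
  have "pres_cong X R u w \<longleftrightarrow> pres_cong X R v w" for w
    using pres_trans[OF uv] pres_trans[OF pres_sym[OF uv]] by blast
  then show "pres_class X R u = pres_class X R v"
    by (simp add: pres_class_def)
qed

lemma carrier_presented_group: "carrier (presented_group X R) = pres_class X R ` gwords X"
  by (simp add: presented_group_def)

lemma one_presented_group: "\<one>\<^bsub>presented_group X R\<^esub> = pres_class X R []"
  by (simp add: presented_group_def)

lemma mult_presented_group:
  assumes "u \<in> gwords X" "v \<in> gwords X"
  shows "pres_class X R u \<otimes>\<^bsub>presented_group X R\<^esub> pres_class X R v = pres_class X R (u @ v)"
proof -
  have "pres_class X R (u' @ v') = pres_class X R (u @ v)"
    if "u' \<in> pres_class X R u" "v' \<in> pres_class X R v" for u' v'
  proof -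
    have "pres_cong X R (u @ v) (u' @ v')"
      using that by (simp add: pres_class_def pres_cong_append)
    then show ?thesis using assms pres_class_eq_iff[of "u @ v" X R "u' @ v'"] by simp
  qed
  moreover have "u \<in> pres_class X R u" "v \<in> pres_class X R v"
    using assms by (simp_all add: pres_class_def pres_refl)
  ultimately have "(\<Union>u'\<in>pres_class X R u. \<Union>v'\<in>pres_class X R v. pres_class X R (u' @ v')) = pres_class X R (u @ v)"
    by blast
  then show ?thesis by (simp add: presented_group_def)
qed

definition word_inv :: "'x gword \<Rightarrow> 'x gword" where
  "word_inv w = rev (map (\<lambda>(b, x). (\<not> b, x)) w)"

lemma word_inv_gwords [simp]: "word_inv w \<in> gwords X \<longleftrightarrow> w \<in> gwords X"
  by (auto simp: word_inv_def gwords_def)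

lemma pres_cong_word_inv:
  assumes "w \<in> gwords X"
  shows "pres_cong X R (word_inv w @ w) []"
  using assms
proof (induction w)
  case Nil
  then show ?case by (auto simp: word_inv_def intro: pres_refl)
next
  case (Cons a w)
  obtain b x where a: "a = (b, x)" by (cases a)
  have "pres_cong X R (word_inv w @ [(\<not> b, x), (\<not> \<not> b, x)] @ w) (word_inv w @ w)"
    using Cons.prems a by (intro pres_cancel) auto
  then show ?case
    using Cons a pres_trans by (fastforce simp: word_inv_def)
qed

lemma pres_class_closed [simp, intro]:
  "w \<in> gwords X \<Longrightarrow> pres_class X R w \<in> carrier (presented_group X R)"
  by (simp add: carrier_presented_group)

lemma presented_group_elem:
  assumes "U \<in> carrier (presented_group X R)"
  obtains w where "w \<in> gwords X" "U = pres_class X R w"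
  using assms by (auto simp: carrier_presented_group)

theorem presented_group_is_group: "group (presented_group X R)" (is "group ?P")
proof (rule groupI)
  fix U V assume "U \<in> carrier ?P" "V \<in> carrier ?P"
  then show "U \<otimes>\<^bsub>?P\<^esub> V \<in> carrier ?P"
    by (elim presented_group_elem) (simp add: mult_presented_group)
next
  fix U V W assume "U \<in> carrier ?P" "V \<in> carrier ?P" "W \<in> carrier ?P"
  then show "U \<otimes>\<^bsub>?P\<^esub> V \<otimes>\<^bsub>?P\<^esub> W = U \<otimes>\<^bsub>?P\<^esub> (V \<otimes>\<^bsub>?P\<^esub> W)"
    by (elim presented_group_elem) (simp add: mult_presented_group)
next
  fix U assume "U \<in> carrier ?P"
  then obtain w where w: "w \<in> gwords X" "U = pres_class X R w" by (rule presented_group_elem)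
  show "\<one>\<^bsub>?P\<^esub> \<otimes>\<^bsub>?P\<^esub> U = U"
    using w by (simp add: one_presented_group mult_presented_group)
  have "pres_class X R (word_inv w @ w) = pres_class X R []"
    using w pres_cong_word_inv[of w X R] by (simp add: pres_class_eq_iff)
  then have "pres_class X R (word_inv w) \<otimes>\<^bsub>?P\<^esub> U = \<one>\<^bsub>?P\<^esub>"
    using w by (simp add: one_presented_group mult_presented_group)
  then show "\<exists>V\<in>carrier ?P. V \<otimes>\<^bsub>?P\<^esub> U = \<one>\<^bsub>?P\<^esub>"
    by (rule bexI) (simp add: w)
qed (simp add: one_presented_group)

lemma presented_group_relation:
  assumes "(u, v) \<in> R" "u \<in> gwords X" "v \<in> gwords X"
  shows "pres_class X R u = pres_class X R v"
  using pres_rel[of "[]" X "[]" u v R] assms by (simp add: pres_class_eq_iff)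

fun word_val :: "('q, 'c) monoid_scheme \<Rightarrow> ('x \<Rightarrow> 'q) \<Rightarrow> 'x gword \<Rightarrow> 'q" where
  "word_val Q f [] = \<one>\<^bsub>Q\<^esub>"
| "word_val Q f ((b, x) # w) = (if b then f x else inv\<^bsub>Q\<^esub> (f x)) \<otimes>\<^bsub>Q\<^esub> word_val Q f w"

lemma (in group) word_val_closed [simp]:
  "f \<in> X \<rightarrow> carrier G \<Longrightarrow> w \<in> gwords X \<Longrightarrow> word_val G f w \<in> carrier G"
  by (induction w) (auto simp: Pi_iff)

lemma (in group) word_val_append:
  "f \<in> X \<rightarrow> carrier G \<Longrightarrow> u \<in> gwords X \<Longrightarrow> v \<in> gwords X \<Longrightarrow>
    word_val G f (u @ v) = word_val G f u \<otimes> word_val G f v"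
proof (induction u)
  case (Cons a u)
  obtain b x where a: "a = (b, x)" by (cases a)
  have "f x \<in> carrier G" using Cons.prems a by auto
  then show ?case
    using Cons word_val_closed[OF Cons.prems(1)] a by (auto simp: m_assoc)
qed simp

text \<open>
  The words with equal values form a congruence that permits free cancellation, hence contain the
  least such congruence over \<open>R\<close> as soon as \<open>R\<close> holds in the group.
\<close>

lemma (in group) word_val_pres_cong:
  assumes f: "f \<in> X \<rightarrow> carrier G"
    and rel: "\<And>u v. (u, v) \<in> R \<Longrightarrow> u \<in> gwords X \<Longrightarrow> v \<in> gwords X \<Longrightarrow> word_val G f u = word_val G f v"
  shows "pres_cong X R u v \<Longrightarrow> word_val G f u = word_val G f v"
proof (induction rule: pres_cong.induct)
  case (pres_cancel p q x b)
  have "f x \<in> carrier G" using f pres_cancel by auto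
  then have "word_val G f [(b, x), (\<not> b, x)] = \<one>" by simp
  then show ?case
    using pres_cancel by (simp add: word_val_append[OF f] word_val_closed[OF f] del: word_val.simps append_Cons)
next
  case (pres_rel p q u v)
  then show ?case using rel[of u v] by (simp add: word_val_append[OF f])
qed simp_all

text \<open>Von Dyck's theorem.\<close>

theorem presented_group_hom:
  assumes Q: "group Q" and f: "f \<in> X \<rightarrow> carrier Q"
    and rel: "\<And>u v. (u, v) \<in> R \<Longrightarrow> u \<in> gwords X \<Longrightarrow> v \<in> gwords X \<Longrightarrow> word_val Q f u = word_val Q f v"
  shows "\<exists>\<theta>\<in>hom (presented_group X R) Q. \<forall>x\<in>X. \<theta> (pres_class X R [(True, x)]) = f x"
proof -
  interpret Q: group Q by fact
  define \<theta> where "\<theta> U = word_val Q f (SOME w. w \<in> U)" for U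
  have \<theta>: "\<theta> (pres_class X R w) = word_val Q f w" if "w \<in> gwords X" for w
  proof -
    have "(SOME v. v \<in> pres_class X R w) \<in> pres_class X R w"
      by (rule someI[of _ w]) (simp add: pres_class_def pres_refl that)
    then have "pres_cong X R w (SOME v. v \<in> pres_class X R w)"
      by (simp add: pres_class_def)
    then have "word_val Q f w = word_val Q f (SOME v. v \<in> pres_class X R w)"
      by (rule Q.word_val_pres_cong[OF f, rotated]) (rule rel)
    then show ?thesis by (simp add: \<theta>_def)
  qed
  \<comment> \<open>The values of words are constant on classes, so the chosen representatives are immaterial.\<close>
  have "\<theta> \<in> hom (presented_group X R) Q"
  proof (rule homI)
    fix U V assume "U \<in> carrier (presented_group X R)" "V \<in> carrier (presented_group X R)"
    then show "\<theta> (U \<otimes>\<^bsub>presented_group X R\<^esub> V) = \<theta> U \<otimes>\<^bsub>Q\<^esub> \<theta> V"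
      by (elim presented_group_elem) (simp add: mult_presented_group \<theta> Q.word_val_append[OF f])
  next
    fix U assume "U \<in> carrier (presented_group X R)"
    then show "\<theta> U \<in> carrier Q"
      by (elim presented_group_elem) (simp add: \<theta> Q.word_val_closed[OF f])
  qed
  moreover have "\<forall>x\<in>X. \<theta> (pres_class X R [(True, x)]) = f x"
    using f by (auto simp: \<theta> Pi_iff)
  ultimately show ?thesis by blast
qed

lemma letter_in_presented_group:
  "x \<in> X \<Longrightarrow> pres_class X R [(b, x)] \<in> carrier (presented_group X R)"
  by (auto simp: carrier_presented_group)

lemma inv_letter_presented_group:
  assumes "x \<in> X"
  shows "inv\<^bsub>presented_group X R\<^esub> (pres_class X R [(True, x)]) = pres_class X R [(False, x)]"
proof -
  interpret group "presented_group X R" by (rule presented_group_is_group)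
  have "pres_class X R ([(False, x), (True, x)]) = pres_class X R []"
    using pres_cancel[of "[]" X "[]" x R False] assms by (subst pres_class_eq_iff) auto
  then show ?thesis using assms
    by (intro inv_equality) (auto simp: letter_in_presented_group mult_presented_group one_presented_group)
qed

lemma presented_group_generated:
  "carrier (presented_group X R) = generate (presented_group X R) ((\<lambda>x. pres_class X R [(True, x)]) ` X)"
    (is "_ = generate ?P ?S")
proof -
  interpret P: group ?P by (rule presented_group_is_group)
  have S: "?S \<subseteq> carrier ?P" by (auto intro: letter_in_presented_group)
  have "pres_class X R w \<in> generate ?P ?S" if "w \<in> gwords X" for w
    using that
  proof (induction w)
    case Nil
    then show ?case using generate.one by (metis one_presented_group)
  next
    case (Cons a w)
    obtain b x where a: "a = (b, x)" by (cases a)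
    have x: "x \<in> X" using Cons.prems a by simp
    have "pres_class X R [(b, x)] \<in> generate ?P ?S"
      using x by (cases b) (auto intro: generate.incl generate.inv simp flip: inv_letter_presented_group)
    then have "pres_class X R [(b, x)] \<otimes>\<^bsub>?P\<^esub> pres_class X R w \<in> generate ?P ?S"
      using Cons a by (auto intro: generate.eng)
    then show ?case using Cons.prems a by (simp add: mult_presented_group)
  qed
  then show ?thesis
    using P.generate_incl[OF S] by (auto simp: carrier_presented_group)
qed

text \<open>
  The multiplication table of a group, imposed as relations, makes the letters multiply like the
  group. Relations such as \<open>1 = []\<close> and \<open>a a\<inverse> = []\<close> are not imposed; they follow because the presented
  structure is already a group.
\<close>

lemma table_rels_hom:
  assumes "table_rels P f \<subseteq> R" "f ` carrier P \<subseteq> X" "group P"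
  shows "(\<lambda>a. pres_class X R [(True, f a)]) \<in> hom P (presented_group X R)"
proof (rule homI)
  interpret P: group P by fact
  fix a b assume ab: "a \<in> carrier P" "b \<in> carrier P"
  then have "([(True, f a), (True, f b)], [(True, f (a \<otimes>\<^bsub>P\<^esub> b))]) \<in> R"
    using assms(1) by (auto simp: table_rels_def)
  moreover have "f a \<in> X" "f b \<in> X" "f (a \<otimes>\<^bsub>P\<^esub> b) \<in> X" using ab assms by auto
  ultimately show "pres_class X R [(True, f (a \<otimes>\<^bsub>P\<^esub> b))] =
      pres_class X R [(True, f a)] \<otimes>\<^bsub>presented_group X R\<^esub> pres_class X R [(True, f b)]"
    using presented_group_relation[of "[(True, f a), (True, f b)]" "[(True, f (a \<otimes>\<^bsub>P\<^esub> b))]" R X]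
    by (simp add: mult_presented_group)
qed (use assms in \<open>auto intro: letter_in_presented_group\<close>)

lemma word_val_table_rels:
  assumes "group Q" "h \<circ> f \<in> hom P Q" "group P" "(u, v) \<in> table_rels P f"
  shows "word_val Q h u = word_val Q h v"
proof -
  interpret Q: group Q by fact
  interpret P: group P by fact
  obtain a b where ab: "a \<in> carrier P" "b \<in> carrier P" "u = [(True, f a), (True, f b)]" "v = [(True, f (a \<otimes>\<^bsub>P\<^esub> b))]"
    using assms(4) by (auto simp: table_rels_def)
  moreover have "h (f x) \<in> carrier Q" if "x \<in> carrier P" for x
    using hom_in_carrier[OF assms(2) that] by simp
  ultimately show ?thesis using hom_mult[OF assms(2), of a b] by simp
qed

section \<open>Multiple HNN-extensions\<close>

lemma hnn_is_group: "group (hnn G I A)"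
  unfolding hnn_def by (rule presented_group_is_group)

lemma hnn_base_hom: "group G \<Longrightarrow> hnn_base G I A \<in> hom G (hnn G I A)"
  unfolding hnn_def hnn_base_def
  by (rule table_rels_hom) (auto simp: hnn_rels_def hnn_gens_def)

lemma hnn_stable_closed: "i \<in> I \<Longrightarrow> hnn_stable G I A i \<in> carrier (hnn G I A)"
  unfolding hnn_def hnn_stable_def by (rule letter_in_presented_group) (simp add: hnn_gens_def)

lemma hnn_generated:
  "carrier (hnn G I A) = generate (hnn G I A) (hnn_base G I A ` carrier G \<union> hnn_stable G I A ` I)"
proof -
  have "hnn_base G I A ` carrier G \<union> hnn_stable G I A ` I =
      (\<lambda>x. pres_class (hnn_gens G I) (hnn_rels G I A) [(True, x)]) ` hnn_gens G I"
    by (auto simp: hnn_gens_def hnn_base_def hnn_stable_def)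
  then show ?thesis unfolding hnn_def by (metis presented_group_generated)
qed

lemma hnn_stable_commutes:
  assumes G: "group G" and a: "a \<in> A i" "a \<in> carrier G" and i: "i \<in> I"
  shows "hnn_base G I A a \<otimes>\<^bsub>hnn G I A\<^esub> hnn_stable G I A i =
    hnn_stable G I A i \<otimes>\<^bsub>hnn G I A\<^esub> hnn_base G I A a"
proof -
  interpret E: group "hnn G I A" by (rule hnn_is_group)
  let ?X = "hnn_gens G I" let ?R = "hnn_rels G I A"
  let ?b = "hnn_base G I A a" let ?t = "hnn_stable G I A i"
  have X: "Inl a \<in> ?X" "Inr i \<in> ?X" using a i by (auto simp: hnn_gens_def)
  have b: "?b \<in> carrier (hnn G I A)" using hom_in_carrier[OF hnn_base_hom[OF G] a(2)] .
  have t: "?t \<in> carrier (hnn G I A)" using hnn_stable_closed[OF i] .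
  have "pres_class ?X ?R [(False, Inr i), (True, Inl a), (True, Inr i)] = pres_class ?X ?R [(True, Inl a)]"
    using a i X by (intro presented_group_relation) (auto simp: hnn_rels_def)
  then have "inv\<^bsub>hnn G I A\<^esub> ?t \<otimes>\<^bsub>hnn G I A\<^esub> (?b \<otimes>\<^bsub>hnn G I A\<^esub> ?t) = ?b"
    using X unfolding hnn_def hnn_stable_def hnn_base_def
    by (simp add: mult_presented_group inv_letter_presented_group)
  then show ?thesis using b t by (metis E.inv_solve_left E.m_closed)
qed

lemma hnn_hom:
  assumes G: "group G" and Q: "group Q" and f: "f \<in> hom G Q"
    and s: "\<And>i. i \<in> I \<Longrightarrow> s i \<in> carrier Q"
    and fs: "\<And>i a. i \<in> I \<Longrightarrow> a \<in> A i \<Longrightarrow> a \<in> carrier G \<Longrightarrow> f a \<otimes>\<^bsub>Q\<^esub> s i = s i \<otimes>\<^bsub>Q\<^esub> f a"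
  shows "\<exists>\<theta>\<in>hom (hnn G I A) Q. (\<forall>a\<in>carrier G. \<theta> (hnn_base G I A a) = f a) \<and>
    (\<forall>i\<in>I. \<theta> (hnn_stable G I A i) = s i)"
proof -
  interpret Q: group Q by fact
  let ?X = "hnn_gens G I" let ?R = "hnn_rels G I A" let ?h = "case_sum f s"
  have "word_val Q ?h u = word_val Q ?h v" if uv: "(u, v) \<in> ?R" "u \<in> gwords ?X" "v \<in> gwords ?X" for u v
  proof (cases "(u, v) \<in> table_rels G Inl")
    case True
    then show ?thesis
      using word_val_table_rels[OF Q _ G True, of ?h] f by (simp add: comp_def)
  next
    case False
    then obtain i a where ia: "i \<in> I" "a \<in> A i"
      "u = [(False, Inr i), (True, Inl a), (True, Inr i)]" "v = [(True, Inl a)]"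
      using uv(1) by (auto simp: hnn_rels_def)
    have a: "a \<in> carrier G" using uv(3) ia by (auto simp: hnn_gens_def)
    have c: "f a \<in> carrier Q" "s i \<in> carrier Q" using hom_in_carrier[OF f a] s[OF ia(1)] by auto
    then have "inv\<^bsub>Q\<^esub> s i \<otimes>\<^bsub>Q\<^esub> (f a \<otimes>\<^bsub>Q\<^esub> s i) = f a"
      unfolding fs[OF ia(1,2) a] by (simp add: Q.m_assoc[symmetric])
    then show ?thesis using ia c by simp
  qed
  moreover have "?h \<in> ?X \<rightarrow> carrier Q"
    using hom_in_carrier[OF f] s by (auto simp: hnn_gens_def)
  ultimately obtain \<theta> where "\<theta> \<in> hom (presented_group ?X ?R) Q"
    "\<forall>x\<in>?X. \<theta> (pres_class ?X ?R [(True, x)]) = ?h x"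
    using presented_group_hom[OF Q, of ?h ?X ?R] by blast
  then show ?thesis
    by (intro bexI[of _ \<theta>]) (auto simp: hnn_def hnn_base_def hnn_stable_def hnn_gens_def)
qed

section \<open>Iterated amalgamated products\<close>

lemma amalg_is_group: "group (amalg P Q M f g)"
  unfolding amalg_def by (rule presented_group_is_group)

lemma amalg_left_hom: "group P \<Longrightarrow> amalg_left P Q M f g \<in> hom P (amalg P Q M f g)"
  unfolding amalg_def amalg_left_def
  by (rule table_rels_hom) (auto simp: amalg_rels_def amalg_gens_def)

lemma amalg_right_hom: "group Q \<Longrightarrow> amalg_right P Q M f g \<in> hom Q (amalg P Q M f g)"
  unfolding amalg_def amalg_right_def
  by (rule table_rels_hom) (auto simp: amalg_rels_def amalg_gens_def)

lemma amalg_left_eq_right: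
  assumes "m \<in> M" "f m \<in> carrier P" "g m \<in> carrier Q"
  shows "amalg_left P Q M f g (f m) = amalg_right P Q M f g (g m)"
  unfolding amalg_left_def amalg_right_def
  using assms by (intro presented_group_relation) (auto simp: amalg_rels_def amalg_gens_def)

lemma amalg_hom:
  assumes P: "group P" and Q: "group Q" and Z: "group Z"
    and h: "h \<in> hom P Z" and k: "k \<in> hom Q Z"
    and hk: "\<And>m. m \<in> M \<Longrightarrow> h (f m) = k (g m)"
  shows "\<exists>\<theta>\<in>hom (amalg P Q M f g) Z. (\<forall>a\<in>carrier P. \<theta> (amalg_left P Q M f g a) = h a) \<and>
    (\<forall>b\<in>carrier Q. \<theta> (amalg_right P Q M f g b) = k b)"
proof -
  interpret Z: group Z by fact
  let ?X = "amalg_gens P Q" let ?R = "amalg_rels P Q M f g" let ?h = "case_sum h k"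
  have hX: "?h \<in> ?X \<rightarrow> carrier Z"
    using hom_in_carrier[OF h] hom_in_carrier[OF k] by (auto simp: amalg_gens_def)
  have "word_val Z ?h u = word_val Z ?h v" if uv: "(u, v) \<in> ?R" "u \<in> gwords ?X" "v \<in> gwords ?X" for u v
  proof -
    consider "(u, v) \<in> table_rels P Inl" | "(u, v) \<in> table_rels Q Inr"
      | m where "m \<in> M" "u = [(True, Inl (f m))]" "v = [(True, Inr (g m))]"
      using uv(1) by (auto simp: amalg_rels_def)
    then show ?thesis
    proof cases
      case 1
      then show ?thesis using word_val_table_rels[OF Z _ P 1, of ?h] h by (simp add: comp_def)
    next
      case 2
      then show ?thesis using word_val_table_rels[OF Z _ Q 2, of ?h] k by (simp add: comp_def)
    next
      case 3
      then show ?thesis using hk by simp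
    qed
  qed
  then obtain \<theta> where "\<theta> \<in> hom (presented_group ?X ?R) Z"
    "\<forall>x\<in>?X. \<theta> (pres_class ?X ?R [(True, x)]) = ?h x"
    using presented_group_hom[OF Z hX, of ?R] by blast
  then show ?thesis
    by (intro bexI[of _ \<theta>]) (auto simp: amalg_def amalg_left_def amalg_right_def amalg_gens_def)
qed

text \<open>
  A class of words can be recovered from any word in it, so passing to the codes loses nothing.
\<close>

lemma inj_on_amalg_code: "inj_on amalg_code (carrier (amalg P Q M f g))"
proof (rule inj_onI)
  let ?X = "amalg_gens P Q" let ?R = "amalg_rels P Q M f g"
  fix C D assume C: "C \<in> carrier (amalg P Q M f g)" and D: "D \<in> carrier (amalg P Q M f g)"
    and eq: "amalg_code C = amalg_code D"
  have code: "\<exists>w. amalg_code U = Word w \<and> U = pres_class ?X ?R w"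
    if U: "U \<in> carrier (amalg P Q M f g)" for U
  proof -
    obtain w where w: "w \<in> gwords ?X" "U = pres_class ?X ?R w"
      using U unfolding amalg_def by (rule presented_group_elem)
    then have "w \<in> U" by (simp add: pres_class_def pres_refl)
    then have "(SOME w. w \<in> U) \<in> U" by (rule someI)
    then have "pres_cong ?X ?R w (SOME w. w \<in> U)" by (simp add: w(2) pres_class_def)
    then have "U = pres_class ?X ?R (SOME w. w \<in> U)"
      using w pres_class_eq_iff by metis
    then show ?thesis unfolding amalg_code_def by blast
  qed
  from code[OF C] code[OF D] eq show "C = D" by auto
qed

lemma iter_amalg_Suc:
  assumes "n \<ge> 1" "iter_amalg H M \<iota> n = (P, \<phi>)"
  shows "iter_amalg H M \<iota> (Suc n) =
    (image_group amalg_code (amalg P (H (Suc n)) M (\<phi> 1 \<circ> \<iota> 1) (\<iota> (Suc n))),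
     \<lambda>i. if i = Suc n then amalg_code \<circ> amalg_right P (H (Suc n)) M (\<phi> 1 \<circ> \<iota> 1) (\<iota> (Suc n))
         else amalg_code \<circ> amalg_left P (H (Suc n)) M (\<phi> 1 \<circ> \<iota> 1) (\<iota> (Suc n)) \<circ> \<phi> i)"
proof -
  obtain k where "n = Suc k" using assms(1) by (cases n) auto
  then show ?thesis
    using assms(2) by (simp only: iter_amalg.simps(2) Let_def prod.case)
qed

lemma amalg_code_iso: "amalg_code \<in> iso (amalg P Q M f g) (image_group amalg_code (amalg P Q M f g))"
  by (rule inj_imp_image_group_iso[OF inj_on_amalg_code])

text \<open>
  The maps into the iterated amalgam identify the copies of \<open>M\<close> because the \<open>n\<close>-th amalgamation
  glues \<open>\<iota> n\<close> to the copy of \<open>M\<close> that comes from the first factor.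
\<close>

lemma iter_amalg_cocone:
  assumes "n \<ge> 1"
    and "\<And>i. i \<in> {1..n} \<Longrightarrow> group (H i)"
    and "\<And>i m. i \<in> {1..n} \<Longrightarrow> m \<in> M \<Longrightarrow> \<iota> i m \<in> carrier (H i)"
    and "iter_amalg H M \<iota> n = (S, \<phi>)"
  shows "group S \<and> (\<forall>i\<in>{1..n}. \<phi> i \<in> hom (H i) S \<and> (\<forall>m\<in>M. \<phi> i (\<iota> i m) = \<phi> 1 (\<iota> 1 m)))"
  using assms
proof (induction n arbitrary: S \<phi> rule: nat_induct_at_least)
  case base
  have "Base \<in> iso (H 1) (image_group Base (H 1))"
    by (rule inj_imp_image_group_iso) (simp add: inj_on_def)
  moreover have "group (image_group Base (H 1))"
    using base(1)[of 1] by (intro group.inj_imp_image_group_is_group) (simp_all add: inj_on_def)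
  moreover have "S = image_group Base (H 1)" "\<phi> = (\<lambda>i. Base)" using base(3) by auto
  ultimately show ?case by (simp add: iso_def)
next
  case (Suc n)
  obtain P \<psi> where P: "iter_amalg H M \<iota> n = (P, \<psi>)" by fastforce
  have IH: "group P" "\<And>i. i \<in> {1..n} \<Longrightarrow> \<psi> i \<in> hom (H i) P"
    "\<And>i m. i \<in> {1..n} \<Longrightarrow> m \<in> M \<Longrightarrow> \<psi> i (\<iota> i m) = \<psi> 1 (\<iota> 1 m)"
  proof -
    have "group P \<and> (\<forall>i\<in>{1..n}. \<psi> i \<in> hom (H i) P \<and> (\<forall>m\<in>M. \<psi> i (\<iota> i m) = \<psi> 1 (\<iota> 1 m)))"
      by (rule Suc.IH[OF _ _ P]) (simp_all add: Suc.prems)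
    then show "group P" "\<And>i. i \<in> {1..n} \<Longrightarrow> \<psi> i \<in> hom (H i) P"
      "\<And>i m. i \<in> {1..n} \<Longrightarrow> m \<in> M \<Longrightarrow> \<psi> i (\<iota> i m) = \<psi> 1 (\<iota> 1 m)" by blast+
  qed
  let ?k = "Suc n"
  define f where "f = \<psi> 1 \<circ> \<iota> 1"
  let ?A = "amalg P (H ?k) M f (\<iota> ?k)"
  have S: "S = image_group amalg_code ?A"
    and \<phi>k: "\<phi> ?k = amalg_code \<circ> amalg_right P (H ?k) M f (\<iota> ?k)"
    and \<phi>i: "\<And>i. i \<in> {1..n} \<Longrightarrow> \<phi> i = amalg_code \<circ> amalg_left P (H ?k) M f (\<iota> ?k) \<circ> \<psi> i"
    using iter_amalg_Suc[OF Suc.hyps P] Suc.prems(3) by (auto simp: f_def)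
  have one: "1 \<in> {1..n}" using Suc.hyps by simp
  have grS: "group S"
    unfolding S by (rule group.inj_imp_image_group_is_group[OF amalg_is_group inj_on_amalg_code])
  have code: "amalg_code \<in> hom ?A S" using amalg_code_iso unfolding S iso_def by blast
  have Hk: "group (H ?k)" by (rule Suc.prems(1)) simp
  have f: "f m \<in> carrier P" if "m \<in> M" for m
    using hom_in_carrier[OF IH(2)[OF one]] Suc.prems(2)[of 1 m] that by (simp add: f_def)
  have agree: "\<phi> ?k (\<iota> ?k m) = \<phi> 1 (\<iota> 1 m)" if m: "m \<in> M" for m
    using amalg_left_eq_right[of m M f P "\<iota> ?k" "H ?k", OF m f[OF m]] Suc.prems(2)[of ?k m] m
    by (simp add: \<phi>k \<phi>i[OF one] f_def del: One_nat_def)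
  have "\<phi> i \<in> hom (H i) S \<and> (\<forall>m\<in>M. \<phi> i (\<iota> i m) = \<phi> 1 (\<iota> 1 m))" if i: "i \<in> {1..?k}" for i
  proof (cases "i = ?k")
    case True
    then show ?thesis
      using agree hom_compose[OF amalg_right_hom[OF Hk] code] by (simp add: \<phi>k)
  next
    case False
    then have i': "i \<in> {1..n}" using i by auto
    then show ?thesis
      using hom_compose[OF hom_compose[OF IH(2)[OF i'] amalg_left_hom[OF IH(1)]] code] IH(3)[OF i']
      by (simp add: \<phi>i[OF i'] \<phi>i[OF one] comp_assoc del: One_nat_def)
  qed
  with grS show ?case by blast
qed

text \<open>
  One amalgamation at a time, this is von Dyck's theorem, transported along the coding.
\<close>

lemma iter_amalg_hom:
  fixes Z :: "('z, 'd) monoid_scheme"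
  assumes "n \<ge> 1"
    and "\<And>i. i \<in> {1..n} \<Longrightarrow> group (H i)"
    and "\<And>i m. i \<in> {1..n} \<Longrightarrow> m \<in> M \<Longrightarrow> \<iota> i m \<in> carrier (H i)"
    and "iter_amalg H M \<iota> n = (S, \<phi>)"
    and Z: "group Z"
    and "\<And>i. i \<in> {1..n} \<Longrightarrow> \<theta> i \<in> hom (H i) Z"
    and "\<And>i m. i \<in> {1..n} \<Longrightarrow> m \<in> M \<Longrightarrow> \<theta> i (\<iota> i m) = \<theta> 1 (\<iota> 1 m)"
  shows "\<exists>\<Theta>\<in>hom S Z. \<forall>i\<in>{1..n}. \<forall>h\<in>carrier (H i). \<Theta> (\<phi> i h) = \<theta> i h"
  using assms(1-4,6,7)
proof (induction n arbitrary: S \<phi> rule: nat_induct_at_least)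
  case base
  have H1: "group (H 1)" and S: "S = image_group Base (H 1)" "\<phi> = (\<lambda>i. Base)"
    using base by auto
  have inj: "inj_on Base (carrier (H 1))" by (simp add: inj_on_def)
  define dec where "dec = inv_into (carrier (H 1)) Base"
  have "dec \<in> iso S (H 1)"
    unfolding dec_def S by (rule group.iso_set_sym[OF H1 inj_imp_image_group_iso[OF inj]])
  then have "\<theta> 1 \<circ> dec \<in> hom S Z"
    using base(4)[of 1] by (auto simp: iso_def intro: hom_compose)
  moreover have "(\<theta> 1 \<circ> dec) (\<phi> 1 h) = \<theta> 1 h" if "h \<in> carrier (H 1)" for h
    using that inj by (simp add: S dec_def)
  ultimately show ?case by (intro bexI[of _ "\<theta> 1 \<circ> dec"]) simp_all
next
  case (Suc n)
  obtain P \<psi> where P: "iter_amalg H M \<iota> n = (P, \<psi>)" by fastforce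
  let ?k = "Suc n"
  have cocone: "group P" "\<And>i. i \<in> {1..n} \<Longrightarrow> \<psi> i \<in> hom (H i) P"
  proof -
    have "group P \<and> (\<forall>i\<in>{1..n}. \<psi> i \<in> hom (H i) P \<and> (\<forall>m\<in>M. \<psi> i (\<iota> i m) = \<psi> 1 (\<iota> 1 m)))"
      by (rule iter_amalg_cocone[OF Suc.hyps _ _ P]) (simp_all add: Suc.prems)
    then show "group P" "\<And>i. i \<in> {1..n} \<Longrightarrow> \<psi> i \<in> hom (H i) P" by blast+
  qed
  have "\<exists>\<Theta>\<in>hom P Z. \<forall>i\<in>{1..n}. \<forall>h\<in>carrier (H i). \<Theta> (\<psi> i h) = \<theta> i h"
    by (rule Suc.IH[OF _ _ P]; rule Suc.prems; simp)
  then obtain \<Theta> where \<Theta>1: "\<Theta> \<in> hom P Z"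
    and \<Theta>2: "\<forall>i\<in>{1..n}. \<forall>h\<in>carrier (H i). \<Theta> (\<psi> i h) = \<theta> i h" by blast
  define f where "f = \<psi> 1 \<circ> \<iota> 1"
  let ?A = "amalg P (H ?k) M f (\<iota> ?k)"
  have S: "S = image_group amalg_code ?A"
    and \<phi>k: "\<phi> ?k = amalg_code \<circ> amalg_right P (H ?k) M f (\<iota> ?k)"
    and \<phi>i: "\<And>i. i \<in> {1..n} \<Longrightarrow> \<phi> i = amalg_code \<circ> amalg_left P (H ?k) M f (\<iota> ?k) \<circ> \<psi> i"
    using iter_amalg_Suc[OF Suc.hyps P] Suc.prems(3) by (auto simp: f_def)
  have one: "1 \<in> {1..n}" using Suc.hyps by simp
  have Hk: "group (H ?k)" by (rule Suc.prems(1)) simp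
  have "\<Theta> (f m) = \<theta> ?k (\<iota> ?k m)" if m: "m \<in> M" for m
    using bspec[OF bspec[OF \<Theta>2 one], of "\<iota> 1 m"] Suc.prems(2)[of 1 m] Suc.prems(5)[of ?k m] m by (simp add: f_def)
  then have "\<exists>\<Omega>\<in>hom ?A Z. (\<forall>a\<in>carrier P. \<Omega> (amalg_left P (H ?k) M f (\<iota> ?k) a) = \<Theta> a) \<and>
      (\<forall>b\<in>carrier (H ?k). \<Omega> (amalg_right P (H ?k) M f (\<iota> ?k) b) = \<theta> ?k b)"
    by (intro amalg_hom[OF cocone(1) Hk Z \<Theta>1 Suc.prems(4)]) simp_all
  then obtain \<Omega> where \<Omega>: "\<Omega> \<in> hom ?A Z"
    "\<forall>a\<in>carrier P. \<Omega> (amalg_left P (H ?k) M f (\<iota> ?k) a) = \<Theta> a"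
    "\<forall>b\<in>carrier (H ?k). \<Omega> (amalg_right P (H ?k) M f (\<iota> ?k) b) = \<theta> ?k b"
    by blast
  define dec where "dec = inv_into (carrier ?A) amalg_code"
  have "dec \<in> iso S ?A"
    unfolding dec_def S by (rule group.iso_set_sym[OF amalg_is_group amalg_code_iso])
  then have hom: "\<Omega> \<circ> dec \<in> hom S Z"
    using \<Omega>(1) by (auto simp: iso_def intro: hom_compose)
  have dec: "dec (amalg_code x) = x" if "x \<in> carrier ?A" for x
    unfolding dec_def using that by (rule inv_into_f_f[OF inj_on_amalg_code])
  have "(\<Omega> \<circ> dec) (\<phi> i h) = \<theta> i h" if i: "i \<in> {1..?k}" and h: "h \<in> carrier (H i)" for i h
  proof (cases "i = ?k")
    case True
    then show ?thesis
      using hom_in_carrier[OF amalg_right_hom[OF Hk, of P M f "\<iota> ?k"], of h] True h \<Omega>(3) by (simp add: \<phi>k dec)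
  next
    case False
    then have i': "i \<in> {1..n}" using i by auto
    have "\<psi> i h \<in> carrier P" using hom_in_carrier[OF cocone(2)[OF i'] h] .
    then show ?thesis
      using hom_in_carrier[OF amalg_left_hom[OF cocone(1), of "H ?k" M f "\<iota> ?k"]] \<Omega>(2) bspec[OF bspec[OF \<Theta>2 i'] h]
      by (simp add: \<phi>i[OF i'] dec)
  qed
  then show ?case using hom by blast
qed

section \<open>Actions of several groups that agree on a common subgroup\<close>

lemma (in group) action_hom_BijGroup:
  assumes closed: "\<And>g w. g \<in> carrier G \<Longrightarrow> w \<in> W \<Longrightarrow> act g w \<in> W"
    and one: "\<And>w. w \<in> W \<Longrightarrow> act \<one> w = w"
    and mult: "\<And>g h w. g \<in> carrier G \<Longrightarrow> h \<in> carrier G \<Longrightarrow> w \<in> W \<Longrightarrow> act (g \<otimes> h) w = act g (act h w)"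
  shows "(\<lambda>g. restrict (act g) W) \<in> hom G (BijGroup W)"
proof -
  have Bij: "restrict (act g) W \<in> Bij W" if g: "g \<in> carrier G" for g
  proof -
    have "bij_betw (act g) W W"
      by (rule bij_betw_byWitness[where f' = "act (inv g)"])
        (use g closed in \<open>auto simp: mult[symmetric] one\<close>)
    then show ?thesis by (simp add: Bij_def)
  qed
  then show ?thesis
    by (intro homI) (auto simp: BijGroup_def compose_def restrict_def fun_eq_iff mult closed)
qed

text \<open>
  The elements that act on the image of \<open>u\<close> as left translations form a subgroup.
\<close>

lemma (in group) translations_from_generators:
  assumes \<Phi>: "\<Phi> \<in> hom G (BijGroup \<Omega>)"
    and X: "X \<subseteq> carrier G" "carrier G = generate G X"
    and u: "u ` carrier G \<subseteq> \<Omega>"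
    and X_u: "\<And>h x. h \<in> X \<Longrightarrow> x \<in> carrier G \<Longrightarrow> \<Phi> h (u x) = u (h \<otimes> x)"
    and y: "y \<in> carrier G" and x: "x \<in> carrier G"
  shows "\<Phi> y (u x) = u (y \<otimes> x)"
proof -
  interpret B: group "BijGroup \<Omega>" by (rule group_BijGroup)
  interpret \<Phi>: group_hom G "BijGroup \<Omega>" \<Phi> by unfold_locales (rule \<Phi>)
  have \<Phi>_Bij: "\<Phi> y \<in> Bij \<Omega>" if "y \<in> carrier G" for y
    using hom_in_carrier[OF \<Phi> that] by (simp add: BijGroup_def)
  have \<Phi>_mult: "\<Phi> (y \<otimes> z) w = \<Phi> y (\<Phi> z w)" if "y \<in> carrier G" "z \<in> carrier G" "w \<in> \<Omega>" for y z w
    using hom_mult[OF \<Phi> that(1,2)] \<Phi>_Bij that by (simp add: BijGroup_def compose_def)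
  have \<Phi>_one: "\<Phi> \<one> w = w" if "w \<in> \<Omega>" for w
    using that \<Phi>.hom_one by (simp add: BijGroup_def)
  have u\<Omega>: "u z \<in> \<Omega>" if "z \<in> carrier G" for z using u that by blast
  have "y \<in> generate G X" using y X(2) by simp
  then have "\<forall>x\<in>carrier G. \<Phi> y (u x) = u (y \<otimes> x)"
  proof (induction y rule: generate.induct)
    case one
    then show ?case using \<Phi>_one u\<Omega> by simp
  next
    case (incl h)
    then show ?case using X_u by blast
  next
    case (inv h)
    have h: "h \<in> carrier G" using inv X(1) by blast
    show ?case
    proof
      fix x assume x: "x \<in> carrier G"
      have "u x = \<Phi> h (u (inv h \<otimes> x))"
        using X_u[OF inv, of "inv h \<otimes> x"] h x by (simp add: m_assoc[symmetric])
      then have "\<Phi> (inv h) (u x) = \<Phi> (inv h \<otimes> h) (u (inv h \<otimes> x))"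
        using \<Phi>_mult[of "inv h" h "u (inv h \<otimes> x)"] h x u\<Omega> by simp
      then show "\<Phi> (inv h) (u x) = u (inv h \<otimes> x)"
        using h x u\<Omega> \<Phi>_one by simp
    qed
  next
    case (eng h1 h2)
    have h: "h1 \<in> carrier G" "h2 \<in> carrier G" using eng(1,2) X(2) by simp_all
    show ?case using eng(3,4) h u\<Omega> \<Phi>_mult by (simp add: m_assoc)
  qed
  then show ?thesis using x by blast
qed

text \<open>
  The coset \<open>M\<close> itself is represented by \<open>\<one>\<close>, so that the set constructed below has a base point
  that every \<open>\<kappa> i\<close> sends to the neutral element.
\<close>

lemma (in group) transversal:
  assumes "subgroup M G"
  shows "\<exists>rep. rep \<one> = \<one> \<and> (\<forall>x\<in>carrier G. rep x \<in> carrier G \<and> x \<otimes> inv (rep x) \<in> M \<and>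
    (\<forall>m\<in>M. rep (m \<otimes> x) = rep x))"
proof -
  interpret M: subgroup M G by fact
  define rep where "rep x = (if x \<in> M then \<one> else SOME y. y \<in> M #> x)" for x
  have some: "(SOME y. y \<in> M #> x) \<in> M #> x" if "x \<in> carrier G" for x
    by (rule someI) (rule rcos_self[OF that assms])
  have "rep x \<in> carrier G \<and> x \<otimes> inv (rep x) \<in> M" if x: "x \<in> carrier G" for x
  proof (cases "x \<in> M")
    case True
    then show ?thesis using x by (simp add: rep_def)
  next
    case False
    then obtain m where m: "m \<in> M" "rep x = m \<otimes> x"
      using some[OF x] by (auto simp: rep_def r_coset_def)
    then have "x \<otimes> inv (rep x) = inv m"
      using x by (simp add: inv_mult_group m_assoc[symmetric])
    then show ?thesis using m x by simp
  qed
  moreover have "rep (m \<otimes> x) = rep x" if m: "m \<in> M" and x: "x \<in> carrier G" for m x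
  proof -
    have "m \<otimes> x \<in> M \<longleftrightarrow> x \<in> M"
      using m x by (metis M.m_closed M.m_inv_closed M.mem_carrier inv_solve_left m_closed)
    moreover have "M #> (m \<otimes> x) = M #> x"
      using coset_mult_assoc[OF M.subset, of m x] coset_join2[OF _ assms m] m x by simp
    ultimately show ?thesis by (simp add: rep_def)
  qed
  moreover have "rep \<one> = \<one>" by (simp add: rep_def)
  ultimately show ?thesis by blast
qed

text \<open>
  A substitute for the amalgamated product of the \<open>K i\<close> acting on itself. The set is
  \<open>W = M \<times> (\<Prod>i\<in>I. C i)\<close> with transversals \<open>C i\<close> of the cosets \<open>M k\<close> in \<open>K i\<close>. Multiplication identifies
  \<open>M \<times> C i\<close> with \<open>K i\<close>; by this identification \<open>K i\<close> acts on the coordinates \<open>M\<close> and \<open>C i\<close> and fixes the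
  others. An element of \<open>M\<close> only changes the coordinate in \<open>M\<close>, in the same way for every \<open>i\<close>.
\<close>

lemma common_action:
  fixes M :: "'a monoid" and K :: "'i \<Rightarrow> 'a monoid" and I :: "'i set"
  assumes M: "group M"
    and K: "\<And>i. i \<in> I \<Longrightarrow> group (K i)"
    and MK: "\<And>i. i \<in> I \<Longrightarrow> (\<lambda>x. x) \<in> hom M (K i)"
  obtains W :: "('a \<times> ('i \<Rightarrow> 'a)) set" and act \<kappa> w0 where
    "\<And>i k w. i \<in> I \<Longrightarrow> k \<in> carrier (K i) \<Longrightarrow> w \<in> W \<Longrightarrow> act i k w \<in> W"
    "\<And>i w. i \<in> I \<Longrightarrow> w \<in> W \<Longrightarrow> act i \<one>\<^bsub>K i\<^esub> w = w"
    "\<And>i k l w. i \<in> I \<Longrightarrow> k \<in> carrier (K i) \<Longrightarrow> l \<in> carrier (K i) \<Longrightarrow> w \<in> W \<Longrightarrow>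
      act i (k \<otimes>\<^bsub>K i\<^esub> l) w = act i k (act i l w)"
    "\<And>i j m w. i \<in> I \<Longrightarrow> j \<in> I \<Longrightarrow> m \<in> carrier M \<Longrightarrow> w \<in> W \<Longrightarrow> act i m w = act j m w"
    "\<And>i w. i \<in> I \<Longrightarrow> w \<in> W \<Longrightarrow> \<kappa> i w \<in> carrier (K i)"
    "\<And>i k w. i \<in> I \<Longrightarrow> k \<in> carrier (K i) \<Longrightarrow> w \<in> W \<Longrightarrow> \<kappa> i (act i k w) = k \<otimes>\<^bsub>K i\<^esub> \<kappa> i w"
    "w0 \<in> W" "\<And>i. i \<in> I \<Longrightarrow> \<kappa> i w0 = \<one>\<^bsub>K i\<^esub>"
proof -
  have MK_mult: "m \<otimes>\<^bsub>K i\<^esub> n = m \<otimes>\<^bsub>M\<^esub> n" if "i \<in> I" "m \<in> carrier M" "n \<in> carrier M" for i m n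
    using hom_mult[OF MK[OF that(1)] that(2,3)] by simp
  have MK_one: "\<one>\<^bsub>M\<^esub> = \<one>\<^bsub>K i\<^esub>" if "i \<in> I" for i
    using hom_one[OF MK[OF that] M K[OF that]] .
  have sub: "subgroup (carrier M) (K i)" if "i \<in> I" for i
    using group_hom.img_is_subgroup[of M "K i" "\<lambda>x. x"] M K[OF that] MK[OF that]
    by (simp add: group_hom_def group_hom_axioms_def)
  have "\<forall>i\<in>I. \<exists>rep. rep \<one>\<^bsub>K i\<^esub> = \<one>\<^bsub>K i\<^esub> \<and> (\<forall>x\<in>carrier (K i). rep x \<in> carrier (K i) \<and>
      x \<otimes>\<^bsub>K i\<^esub> inv\<^bsub>K i\<^esub> (rep x) \<in> carrier M \<and> (\<forall>m\<in>carrier M. rep (m \<otimes>\<^bsub>K i\<^esub> x) = rep x))"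
    using group.transversal[OF K sub] by simp
  from bchoice[OF this] obtain rep where rep_all: "\<forall>i\<in>I. rep i \<one>\<^bsub>K i\<^esub> = \<one>\<^bsub>K i\<^esub> \<and>
      (\<forall>x\<in>carrier (K i). rep i x \<in> carrier (K i) \<and> x \<otimes>\<^bsub>K i\<^esub> inv\<^bsub>K i\<^esub> (rep i x) \<in> carrier M \<and>
        (\<forall>m\<in>carrier M. rep i (m \<otimes>\<^bsub>K i\<^esub> x) = rep i x))" by blast
  then have rep:
    "\<And>i x. i \<in> I \<Longrightarrow> x \<in> carrier (K i) \<Longrightarrow> rep i x \<in> carrier (K i)"
    "\<And>i x. i \<in> I \<Longrightarrow> x \<in> carrier (K i) \<Longrightarrow> x \<otimes>\<^bsub>K i\<^esub> inv\<^bsub>K i\<^esub> (rep i x) \<in> carrier M"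
    "\<And>i m x. i \<in> I \<Longrightarrow> m \<in> carrier M \<Longrightarrow> x \<in> carrier (K i) \<Longrightarrow> rep i (m \<otimes>\<^bsub>K i\<^esub> x) = rep i x"
    "\<And>i. i \<in> I \<Longrightarrow> rep i \<one>\<^bsub>K i\<^esub> = \<one>\<^bsub>K i\<^esub>"
    by simp_all
  define C where "C i = {x \<in> carrier (K i). rep i x = x}" for i
  \<comment> \<open>\<open>rep\<close> is idempotent, because \<open>x\<close> and \<open>rep i x\<close> lie in the same coset.\<close>
  have rep_C: "rep i x \<in> C i" if i: "i \<in> I" and x: "x \<in> carrier (K i)" for i x
  proof -
    interpret K: group "K i" using K[OF i] .
    have "rep i (x \<otimes>\<^bsub>K i\<^esub> inv\<^bsub>K i\<^esub> (rep i x) \<otimes>\<^bsub>K i\<^esub> rep i x) = rep i (rep i x)"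
      using rep i x by blast
    then show ?thesis using rep(1)[OF i x] x by (simp add: C_def K.m_assoc)
  qed
  define W where "W = {(m, c). m \<in> carrier M \<and> (\<forall>i\<in>I. c i \<in> C i)}"
  define \<kappa> where "\<kappa> i w = fst w \<otimes>\<^bsub>K i\<^esub> snd w i" for i and w :: "'a \<times> ('i \<Rightarrow> 'a)"
  \<comment> \<open>replaces the coordinates of \<open>w\<close> that make up \<open>\<kappa> i w\<close> by those of \<open>x\<close>\<close>
  define set\<kappa> where "set\<kappa> i x w = (x \<otimes>\<^bsub>K i\<^esub> inv\<^bsub>K i\<^esub> (rep i x), (snd w)(i := rep i x))"
    for i x and w :: "'a \<times> ('i \<Rightarrow> 'a)"
  define act where "act i k w = set\<kappa> i (k \<otimes>\<^bsub>K i\<^esub> \<kappa> i w) w" for i k w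
  define w0 where "w0 = (\<one>\<^bsub>M\<^esub>, \<lambda>i. \<one>\<^bsub>K i\<^esub>)"
  have MinK: "m \<in> carrier (K i)" if "i \<in> I" "m \<in> carrier M" for i m
    using subgroup.mem_carrier[OF sub] that by blast
  have \<kappa>_closed: "\<kappa> i w \<in> carrier (K i)" if i: "i \<in> I" and w: "w \<in> W" for i w
  proof -
    interpret K: group "K i" using K[OF i] .
    show ?thesis using i w MinK by (auto simp: \<kappa>_def W_def C_def)
  qed
  have set\<kappa>_W: "set\<kappa> i x w \<in> W" if "i \<in> I" "x \<in> carrier (K i)" "w \<in> W" for i x w
    using that rep(2) rep_C by (auto simp: set\<kappa>_def W_def)
  have \<kappa>_set\<kappa>: "\<kappa> i (set\<kappa> i x w) = x" if i: "i \<in> I" and x: "x \<in> carrier (K i)" for i x w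
  proof -
    interpret K: group "K i" using K[OF i] .
    show ?thesis using rep(1)[OF i x] x by (simp add: \<kappa>_def set\<kappa>_def K.m_assoc)
  qed
  \<comment> \<open>Multiplying \<open>\<kappa> i w\<close> by \<open>m \<in> M\<close> does not change its coset, hence not the coordinate in \<open>C i\<close>.\<close>
  have act_M: "act i m w = (m \<otimes>\<^bsub>M\<^esub> fst w, snd w)"
    if i: "i \<in> I" and m: "m \<in> carrier M" and w: "w \<in> W" for i m w
  proof -
    interpret K: group "K i" using K[OF i] .
    interpret M: group M by fact
    obtain n c where nc: "w = (n, c)" "n \<in> carrier M" "c i \<in> carrier (K i)" "rep i (c i) = c i"
      using w i by (auto simp: W_def C_def)
    have mn: "m \<otimes>\<^bsub>M\<^esub> n \<in> carrier M" using m nc by simp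
    then have mnK: "m \<otimes>\<^bsub>M\<^esub> n \<in> carrier (K i)" using MinK i by blast
    have x: "m \<otimes>\<^bsub>K i\<^esub> \<kappa> i w = m \<otimes>\<^bsub>M\<^esub> n \<otimes>\<^bsub>K i\<^esub> c i"
      using m nc i MinK by (simp add: \<kappa>_def K.m_assoc[symmetric] MK_mult)
    have "rep i (m \<otimes>\<^bsub>M\<^esub> n \<otimes>\<^bsub>K i\<^esub> c i) = c i" using rep(3)[OF i mn nc(3)] nc(4) by simp
    then show ?thesis using nc mnK by (simp add: act_def x[unfolded nc(1)] set\<kappa>_def K.m_assoc)
  qed
  show thesis
  proof (rule that[of W act \<kappa> w0])
    show "act i k w \<in> W" "\<kappa> i (act i k w) = k \<otimes>\<^bsub>K i\<^esub> \<kappa> i w"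
      if i: "i \<in> I" and k: "k \<in> carrier (K i)" and w: "w \<in> W" for i k w
    proof -
      interpret K: group "K i" using K[OF i] .
      have "k \<otimes>\<^bsub>K i\<^esub> \<kappa> i w \<in> carrier (K i)" using k \<kappa>_closed[OF i w] by simp
      then show "act i k w \<in> W" "\<kappa> i (act i k w) = k \<otimes>\<^bsub>K i\<^esub> \<kappa> i w"
        using i w by (simp_all add: act_def set\<kappa>_W \<kappa>_set\<kappa>)
    qed
    show "act i \<one>\<^bsub>K i\<^esub> w = w" if i: "i \<in> I" and w: "w \<in> W" for i w
    proof -
      interpret M: group M by fact
      show ?thesis using act_M[OF i M.one_closed w] w by (auto simp: MK_one[OF i] W_def)
        (metis M.l_one MK_one i)
    qed
    show "act i (k \<otimes>\<^bsub>K i\<^esub> l) w = act i k (act i l w)"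
      if i: "i \<in> I" and k: "k \<in> carrier (K i)" and l: "l \<in> carrier (K i)" and w: "w \<in> W" for i k l w
    proof -
      interpret K: group "K i" using K[OF i] .
      have "\<kappa> i (act i l w) = l \<otimes>\<^bsub>K i\<^esub> \<kappa> i w"
        using l \<kappa>_closed[OF i w] i by (simp add: act_def \<kappa>_set\<kappa>)
      moreover have "set\<kappa> i x (set\<kappa> i y w) = set\<kappa> i x w" for x y by (simp add: set\<kappa>_def)
      ultimately show ?thesis
        using k l \<kappa>_closed[OF i w] by (simp add: act_def K.m_assoc)
    qed
    show "act i m w = act j m w" if "i \<in> I" "j \<in> I" "m \<in> carrier M" "w \<in> W" for i j m w
      using act_M that by simp
    show "w0 \<in> W"
    proof -
      have "\<one>\<^bsub>K i\<^esub> \<in> carrier (K i)" if "i \<in> I" for i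
        using K[OF that] by (simp add: group.is_monoid)
      then show ?thesis using M rep(4) by (auto simp: w0_def W_def C_def group.is_monoid)
    qed
    show "\<kappa> i w0 = \<one>\<^bsub>K i\<^esub>" if i: "i \<in> I" for i
    proof -
      interpret K: group "K i" using K[OF i] .
      show ?thesis by (simp add: w0_def \<kappa>_def MK_one[OF i])
    qed
  qed (rule \<kappa>_closed)
qed

section \<open>Extending the regular representation of an HNN-extension\<close>

text \<open>
  Here \<open>E\<close> stands for the multiple HNN-extension of \<open>G\<close>, with base embedding \<open>\<beta>\<close>, stable letters
  \<open>s i\<close> and the retraction \<open>\<rho>\<close> onto \<open>G\<close> that kills them.
  The permutations \<open>T i\<close> act on the fibres of \<open>W \<times> E \<rightarrow> W\<close> by left multiplication
  with elements \<open>\<tau> i k\<close> that depend on the base point \<open>w\<close> through \<open>k = \<kappa> i w\<close>. The value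
  \<open>\<tau> i (l g) = g\<inverse> (s i) g\<close> is forced by the two requirements on \<open>T i\<close>, namely to commute with \<open>L i\<close>
  and to restrict to the translation by \<open>s i\<close> on the copy \<open>u ` E\<close> of \<open>E\<close>.
\<close>

lemma extension_to_permutations:
  fixes M :: "'a monoid" and K :: "'i \<Rightarrow> 'a monoid" and I :: "'i set" and E :: "'e monoid"
  assumes M: "group M"
    and K: "\<And>i. i \<in> I \<Longrightarrow> group (K i)"
    and MK: "\<And>i. i \<in> I \<Longrightarrow> (\<lambda>x. x) \<in> hom M (K i)"
    and G: "subgroup G M"
    and L: "\<And>i. i \<in> I \<Longrightarrow> subgroup (L i) (K i)"
    and I: "I \<noteq> {}"
    and E: "group E"
    and \<beta>: "\<beta> \<in> hom (M\<lparr>carrier := G\<rparr>) E"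
    and s: "\<And>i. i \<in> I \<Longrightarrow> s i \<in> carrier E"
    and comm: "\<And>i a. i \<in> I \<Longrightarrow> a \<in> G \<Longrightarrow> a \<in> L i \<Longrightarrow> \<beta> a \<otimes>\<^bsub>E\<^esub> s i = s i \<otimes>\<^bsub>E\<^esub> \<beta> a"
    and \<rho>: "\<rho> \<in> hom E (M\<lparr>carrier := G\<rparr>)"
    and \<rho>\<beta>: "\<And>g. g \<in> G \<Longrightarrow> \<rho> (\<beta> g) = g"
    and \<rho>s: "\<And>i. i \<in> I \<Longrightarrow> \<rho> (s i) = \<one>\<^bsub>M\<^esub>"
  obtains \<Omega> :: "(('a \<times> ('i \<Rightarrow> 'a)) \<times> 'e) set" and \<sigma> T u where
    "\<And>i. i \<in> I \<Longrightarrow> \<sigma> i \<in> hom (K i) (BijGroup \<Omega>)"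
    "\<And>i j m. i \<in> I \<Longrightarrow> j \<in> I \<Longrightarrow> m \<in> carrier M \<Longrightarrow> \<sigma> i m = \<sigma> j m"
    "\<And>i. i \<in> I \<Longrightarrow> T i \<in> carrier (BijGroup \<Omega>)"
    "\<And>i l. i \<in> I \<Longrightarrow> l \<in> L i \<Longrightarrow> \<sigma> i l \<otimes>\<^bsub>BijGroup \<Omega>\<^esub> T i = T i \<otimes>\<^bsub>BijGroup \<Omega>\<^esub> \<sigma> i l"
    "u ` carrier E \<subseteq> \<Omega>" "inj_on u (carrier E)"
    "\<And>i g x. i \<in> I \<Longrightarrow> g \<in> G \<Longrightarrow> x \<in> carrier E \<Longrightarrow> \<sigma> i g (u x) = u (\<beta> g \<otimes>\<^bsub>E\<^esub> x)"
    "\<And>i x. i \<in> I \<Longrightarrow> x \<in> carrier E \<Longrightarrow> T i (u x) = u (s i \<otimes>\<^bsub>E\<^esub> x)"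
proof -
  interpret E: group E by fact
  interpret M: group M by fact
  interpret G: subgroup G M by fact
  obtain W :: "('a \<times> ('i \<Rightarrow> 'a)) set" and act \<kappa> w0 where
    act_W: "\<And>i k w. i \<in> I \<Longrightarrow> k \<in> carrier (K i) \<Longrightarrow> w \<in> W \<Longrightarrow> act i k w \<in> W"
    and act_one: "\<And>i w. i \<in> I \<Longrightarrow> w \<in> W \<Longrightarrow> act i \<one>\<^bsub>K i\<^esub> w = w"
    and act_mult: "\<And>i k l w. i \<in> I \<Longrightarrow> k \<in> carrier (K i) \<Longrightarrow> l \<in> carrier (K i) \<Longrightarrow> w \<in> W \<Longrightarrow>
      act i (k \<otimes>\<^bsub>K i\<^esub> l) w = act i k (act i l w)"
    and act_M: "\<And>i j m w. i \<in> I \<Longrightarrow> j \<in> I \<Longrightarrow> m \<in> carrier M \<Longrightarrow> w \<in> W \<Longrightarrow> act i m w = act j m w"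
    and \<kappa>_K: "\<And>i w. i \<in> I \<Longrightarrow> w \<in> W \<Longrightarrow> \<kappa> i w \<in> carrier (K i)"
    and \<kappa>_act: "\<And>i k w. i \<in> I \<Longrightarrow> k \<in> carrier (K i) \<Longrightarrow> w \<in> W \<Longrightarrow> \<kappa> i (act i k w) = k \<otimes>\<^bsub>K i\<^esub> \<kappa> i w"
    and w0: "w0 \<in> W" "\<And>i. i \<in> I \<Longrightarrow> \<kappa> i w0 = \<one>\<^bsub>K i\<^esub>"
    by (rule common_action[OF M K MK]) blast+
  have MK_mult: "m \<otimes>\<^bsub>K i\<^esub> n = m \<otimes>\<^bsub>M\<^esub> n" if "i \<in> I" "m \<in> carrier M" "n \<in> carrier M" for i m n
    using hom_mult[OF MK[OF that(1)] that(2,3)] by simp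
  have MinK: "m \<in> carrier (K i)" if "i \<in> I" "m \<in> carrier M" for i m
    using hom_in_carrier[OF MK[OF that(1)] that(2)] .
  have GinK: "g \<in> carrier (K i)" if "i \<in> I" "g \<in> G" for i g
    using MinK[OF that(1)] that(2) by simp
  have inv_eq: "inv\<^bsub>K i\<^esub> m = inv\<^bsub>M\<^esub> m" if i: "i \<in> I" and m: "m \<in> carrier M" for i m
    using group_hom.hom_inv[of M "K i" "\<lambda>x. x" m] M K[OF i] MK[OF i] m
    by (simp add: group_hom_def group_hom_axioms_def)
  have \<beta>_closed: "\<beta> g \<in> carrier E" if "g \<in> G" for g
    using hom_in_carrier[OF \<beta>] that by simp
  have \<beta>_mult: "\<beta> (g \<otimes>\<^bsub>M\<^esub> h) = \<beta> g \<otimes>\<^bsub>E\<^esub> \<beta> h" if "g \<in> G" "h \<in> G" for g h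
    using hom_mult[OF \<beta>] that by simp
  have \<rho>_closed: "\<rho> x \<in> G" if "x \<in> carrier E" for x
    using hom_in_carrier[OF \<rho> that] by simp
  have \<rho>_mult: "\<rho> (x \<otimes>\<^bsub>E\<^esub> y) = \<rho> x \<otimes>\<^bsub>M\<^esub> \<rho> y" if "x \<in> carrier E" "y \<in> carrier E" for x y
    using hom_mult[OF \<rho> that] by simp

  \<comment> \<open>the possible second factors of \<open>k\<close> as an element of \<open>L i\<close> times \<open>G\<close>; left multiplication of \<open>k\<close> by \<open>L i\<close> does not affect them\<close>
  define cand where "cand i k = {g \<in> G. k \<otimes>\<^bsub>K i\<^esub> inv\<^bsub>K i\<^esub> g \<in> L i}" for i k
  define \<tau> where "\<tau> i k = (if cand i k = {} then \<one>\<^bsub>E\<^esub> else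
      let g = SOME g. g \<in> cand i k in inv\<^bsub>E\<^esub> (\<beta> g) \<otimes>\<^bsub>E\<^esub> s i \<otimes>\<^bsub>E\<^esub> \<beta> g)" for i k
  have some_cand: "(SOME g. g \<in> cand i k) \<in> cand i k" if "cand i k \<noteq> {}" for i k
    using that by (simp add: some_in_eq)
  have cand_G: "cand i k \<subseteq> G" for i k by (auto simp: cand_def)
  have \<tau>_closed: "\<tau> i k \<in> carrier E" if i: "i \<in> I" for i k
  proof (cases "cand i k = {}")
    case False
    then have "\<beta> (SOME g. g \<in> cand i k) \<in> carrier E"
      using some_cand cand_G \<beta>_closed by blast
    then show ?thesis using s[OF i] by (simp add: \<tau>_def Let_def)
  qed (simp add: \<tau>_def)
  have cand_L: "cand i (l \<otimes>\<^bsub>K i\<^esub> k) = cand i k"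
    if i: "i \<in> I" and l: "l \<in> L i" and k: "k \<in> carrier (K i)" for i l k
  proof -
    interpret K: group "K i" using K[OF i] .
    interpret L: subgroup "L i" "K i" using L[OF i] .
    have "l \<otimes>\<^bsub>K i\<^esub> k \<otimes>\<^bsub>K i\<^esub> inv\<^bsub>K i\<^esub> g \<in> L i \<longleftrightarrow> k \<otimes>\<^bsub>K i\<^esub> inv\<^bsub>K i\<^esub> g \<in> L i" if g: "g \<in> G" for g
    proof -
      let ?y = "k \<otimes>\<^bsub>K i\<^esub> inv\<^bsub>K i\<^esub> g"
      have y: "?y \<in> carrier (K i)" using k GinK[OF i g] by simp
      have "l \<otimes>\<^bsub>K i\<^esub> ?y \<in> L i \<longleftrightarrow> ?y \<in> L i"
      proof
        assume "l \<otimes>\<^bsub>K i\<^esub> ?y \<in> L i"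
        then have "inv\<^bsub>K i\<^esub> l \<otimes>\<^bsub>K i\<^esub> (l \<otimes>\<^bsub>K i\<^esub> ?y) \<in> L i" using l by blast
        then show "?y \<in> L i" using y l by (simp add: K.m_assoc[symmetric])
      qed (use l in simp)
      then show ?thesis using l k GinK[OF i g] by (simp add: K.m_assoc)
    qed
    then show ?thesis by (auto simp: cand_def)
  qed
  have \<tau>_L: "\<tau> i (l \<otimes>\<^bsub>K i\<^esub> k) = \<tau> i k"
    if "i \<in> I" "l \<in> L i" "k \<in> carrier (K i)" for i l k
    using cand_L[OF that] by (simp add: \<tau>_def)
  \<comment> \<open>If \<open>h\<close> is the chosen second factor of \<open>g \<in> G\<close>, then \<open>a = g h\<inverse>\<close> lies in \<open>G \<inter> L i\<close> and so commutes with \<open>s i\<close>.\<close>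
  have \<tau>_G: "\<tau> i g = inv\<^bsub>E\<^esub> (\<beta> g) \<otimes>\<^bsub>E\<^esub> s i \<otimes>\<^bsub>E\<^esub> \<beta> g" if i: "i \<in> I" and g: "g \<in> G" for i g
  proof -
    interpret K: group "K i" using K[OF i] .
    interpret L: subgroup "L i" "K i" using L[OF i] .
    have ne: "g \<in> cand i g" using g GinK[OF i g] by (simp add: cand_def)
    define h where "h = (SOME h. h \<in> cand i g)"
    have "h \<in> cand i g" unfolding h_def using some_cand ne by blast
    then have h: "h \<in> G" and "g \<otimes>\<^bsub>K i\<^esub> inv\<^bsub>K i\<^esub> h \<in> L i" by (auto simp: cand_def)
    define a where "a = g \<otimes>\<^bsub>M\<^esub> inv\<^bsub>M\<^esub> h"
    have a: "a \<in> G" "a \<in> L i" and g_eq: "g = a \<otimes>\<^bsub>M\<^esub> h"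
      using \<open>g \<otimes>\<^bsub>K i\<^esub> inv\<^bsub>K i\<^esub> h \<in> L i\<close> g h i by (simp_all add: a_def inv_eq MK_mult M.m_assoc)
    note [simp] = \<beta>_closed[OF a(1)] \<beta>_closed[OF h] s[OF i]
    have "\<beta> g = \<beta> a \<otimes>\<^bsub>E\<^esub> \<beta> h" using \<beta>_mult[OF a(1) h] g_eq by simp
    then have "inv\<^bsub>E\<^esub> (\<beta> g) \<otimes>\<^bsub>E\<^esub> s i \<otimes>\<^bsub>E\<^esub> \<beta> g =
        inv\<^bsub>E\<^esub> (\<beta> h) \<otimes>\<^bsub>E\<^esub> (inv\<^bsub>E\<^esub> (\<beta> a) \<otimes>\<^bsub>E\<^esub> (s i \<otimes>\<^bsub>E\<^esub> \<beta> a)) \<otimes>\<^bsub>E\<^esub> \<beta> h"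
      by (simp add: E.inv_mult_group E.m_assoc)
    also have "inv\<^bsub>E\<^esub> (\<beta> a) \<otimes>\<^bsub>E\<^esub> (s i \<otimes>\<^bsub>E\<^esub> \<beta> a) = s i"
      unfolding comm[OF i a, symmetric] by (simp add: E.m_assoc[symmetric])
    finally show ?thesis using ne by (auto simp: \<tau>_def Let_def h_def)
  qed

  define \<Omega> where "\<Omega> = W \<times> carrier E"
  define \<sigma> where "\<sigma> i k = restrict (\<lambda>(w, e). (act i k w, e)) \<Omega>" for i k
  define T where "T i = restrict (\<lambda>(w, e). (w, \<tau> i (\<kappa> i w) \<otimes>\<^bsub>E\<^esub> e)) \<Omega>" for i
  obtain i0 where i0: "i0 \<in> I" using I by blast
  define u where "u x = (act i0 (\<rho> x) w0, inv\<^bsub>E\<^esub> (\<beta> (\<rho> x)) \<otimes>\<^bsub>E\<^esub> x)" for x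
  have \<sigma>_hom: "\<sigma> i \<in> hom (K i) (BijGroup \<Omega>)" if i: "i \<in> I" for i
  proof -
    interpret K: group "K i" using K[OF i] .
    show ?thesis unfolding \<sigma>_def
      by (rule K.action_hom_BijGroup) (auto simp: \<Omega>_def act_W[OF i] act_one[OF i] act_mult[OF i])
  qed
  have T_Bij: "T i \<in> Bij \<Omega>" if i: "i \<in> I" for i
  proof -
    have "bij_betw (\<lambda>(w, e). (w, \<tau> i (\<kappa> i w) \<otimes>\<^bsub>E\<^esub> e)) \<Omega> \<Omega>"
      by (rule bij_betw_byWitness[where f' = "\<lambda>(w, e). (w, inv\<^bsub>E\<^esub> \<tau> i (\<kappa> i w) \<otimes>\<^bsub>E\<^esub> e)"])
        (auto simp: \<Omega>_def \<tau>_closed[OF i] E.m_assoc[symmetric])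
    then show ?thesis by (simp add: T_def Bij_def)
  qed
  have \<sigma>T: "\<sigma> i l \<otimes>\<^bsub>BijGroup \<Omega>\<^esub> T i = T i \<otimes>\<^bsub>BijGroup \<Omega>\<^esub> \<sigma> i l" if i: "i \<in> I" and l: "l \<in> L i" for i l
  proof -
    have lK: "l \<in> carrier (K i)" using subgroup.mem_carrier[OF L[OF i] l] .
    have "\<sigma> i l \<in> Bij \<Omega>" using hom_in_carrier[OF \<sigma>_hom[OF i] lK] by (simp add: BijGroup_def)
    moreover have "compose \<Omega> (\<sigma> i l) (T i) = compose \<Omega> (T i) (\<sigma> i l)"
      using i l lK by (auto simp: compose_def \<sigma>_def T_def \<Omega>_def fun_eq_iff \<tau>_closed act_W \<kappa>_act \<tau>_L \<kappa>_K)
    ultimately show ?thesis using T_Bij[OF i] by (simp add: BijGroup_def)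
  qed
  have \<sigma>_M: "\<sigma> i m = \<sigma> j m" if "i \<in> I" "j \<in> I" "m \<in> carrier M" for i j m
    using act_M[OF that] by (auto simp: \<sigma>_def \<Omega>_def restrict_def fun_eq_iff)
  have act_\<rho>_W: "act i0 (\<rho> x) w0 \<in> W" if "x \<in> carrier E" for x
    using act_W[OF i0 GinK[OF i0] w0(1)] \<rho>_closed that by blast
  \<comment> \<open>The base point is mapped to \<open>\<one>\<close> by every \<open>\<kappa> i\<close>, so equivariance gives this for all \<open>i\<close> at once.\<close>
  have \<kappa>_u: "\<kappa> i (act i0 (\<rho> x) w0) = \<rho> x" if i: "i \<in> I" and x: "x \<in> carrier E" for i x
  proof -
    interpret K: group "K i" using K[OF i] .
    have g: "\<rho> x \<in> G" using \<rho>_closed[OF x] .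
    have "act i0 (\<rho> x) w0 = act i (\<rho> x) w0" using act_M[OF i0 i _ w0(1)] g by simp
    then show ?thesis using \<kappa>_act[OF i GinK[OF i g] w0(1)] w0(2)[OF i] GinK[OF i g] by simp
  qed
  have u_\<Omega>: "u ` carrier E \<subseteq> \<Omega>"
  proof (rule image_subsetI)
    fix x assume x: "x \<in> carrier E"
    then show "u x \<in> \<Omega>"
      using act_\<rho>_W[OF x] \<beta>_closed[OF \<rho>_closed[OF x]] by (simp add: u_def \<Omega>_def)
  qed
  have u_inj: "inj_on u (carrier E)"
  proof (rule inj_onI)
    fix x y assume x: "x \<in> carrier E" and y: "y \<in> carrier E" and eq: "u x = u y"
    have act_eq: "act i0 (\<rho> x) w0 = act i0 (\<rho> y) w0"
      and e_eq: "inv\<^bsub>E\<^esub> (\<beta> (\<rho> x)) \<otimes>\<^bsub>E\<^esub> x = inv\<^bsub>E\<^esub> (\<beta> (\<rho> y)) \<otimes>\<^bsub>E\<^esub> y"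
      using eq unfolding u_def by blast+
    have \<rho>_eq: "\<rho> y = \<rho> x" using \<kappa>_u[OF i0 x] \<kappa>_u[OF i0 y] act_eq by metis
    show "x = y"
      using e_eq x y \<beta>_closed[OF \<rho>_closed[OF x]] unfolding \<rho>_eq by simp
  qed
  have \<sigma>_u: "\<sigma> i g (u x) = u (\<beta> g \<otimes>\<^bsub>E\<^esub> x)" if i: "i \<in> I" and g: "g \<in> G" and x: "x \<in> carrier E" for i g x
  proof -
    have r: "\<rho> x \<in> G" using \<rho>_closed[OF x] .
    have \<rho>gx: "\<rho> (\<beta> g \<otimes>\<^bsub>E\<^esub> x) = g \<otimes>\<^bsub>M\<^esub> \<rho> x" using \<rho>_mult[OF \<beta>_closed[OF g] x] \<rho>\<beta>[OF g] by simp
    have "act i g (act i0 (\<rho> x) w0) = act i0 g (act i0 (\<rho> x) w0)"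
      using act_M[OF i i0 _ act_\<rho>_W[OF x]] g by simp
    also have "\<dots> = act i0 (g \<otimes>\<^bsub>M\<^esub> \<rho> x) w0"
      using act_mult[OF i0 GinK[OF i0 g] GinK[OF i0 r] w0(1)] MK_mult[OF i0] g r by simp
    finally have "\<sigma> i g (u x) = (act i0 (g \<otimes>\<^bsub>M\<^esub> \<rho> x) w0, inv\<^bsub>E\<^esub> (\<beta> (\<rho> x)) \<otimes>\<^bsub>E\<^esub> x)"
      using act_\<rho>_W[OF x] \<beta>_closed[OF r] x by (simp add: \<sigma>_def u_def \<Omega>_def)
    moreover have "inv\<^bsub>E\<^esub> (\<beta> (g \<otimes>\<^bsub>M\<^esub> \<rho> x)) \<otimes>\<^bsub>E\<^esub> (\<beta> g \<otimes>\<^bsub>E\<^esub> x) = inv\<^bsub>E\<^esub> (\<beta> (\<rho> x)) \<otimes>\<^bsub>E\<^esub> x"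
    proof -
      have "inv\<^bsub>E\<^esub> (\<beta> g) \<otimes>\<^bsub>E\<^esub> (\<beta> g \<otimes>\<^bsub>E\<^esub> x) = x"
        using \<beta>_closed[OF g] x by (simp add: E.m_assoc[symmetric])
      then show ?thesis
        using \<beta>_closed[OF g] \<beta>_closed[OF r] x by (simp add: \<beta>_mult[OF g r] E.inv_mult_group E.m_assoc)
    qed
    ultimately show ?thesis by (simp add: u_def \<rho>gx)
  qed
  have T_u: "T i (u x) = u (s i \<otimes>\<^bsub>E\<^esub> x)" if i: "i \<in> I" and x: "x \<in> carrier E" for i x
  proof -
    have r: "\<rho> x \<in> G" using \<rho>_closed[OF x] .
    note [simp] = \<beta>_closed[OF r] s[OF i] x
    have \<rho>sx: "\<rho> (s i \<otimes>\<^bsub>E\<^esub> x) = \<rho> x" using \<rho>_mult[OF s[OF i] x] \<rho>s[OF i] r by simp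
    have "T i (u x) = (act i0 (\<rho> x) w0, \<tau> i (\<rho> x) \<otimes>\<^bsub>E\<^esub> (inv\<^bsub>E\<^esub> (\<beta> (\<rho> x)) \<otimes>\<^bsub>E\<^esub> x))"
      using act_\<rho>_W[OF x] by (simp add: T_def u_def \<Omega>_def \<kappa>_u[OF i x])
    moreover have "\<beta> (\<rho> x) \<otimes>\<^bsub>E\<^esub> (inv\<^bsub>E\<^esub> (\<beta> (\<rho> x)) \<otimes>\<^bsub>E\<^esub> x) = x"
      by (simp add: E.m_assoc[symmetric])
    ultimately show ?thesis by (simp add: u_def \<rho>sx \<tau>_G[OF i r] E.m_assoc)
  qed
  have T_carrier: "T i \<in> carrier (BijGroup \<Omega>)" if "i \<in> I" for i
    using T_Bij[OF that] by (simp add: BijGroup_def)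
  show thesis
    by (rule that[OF \<sigma>_hom \<sigma>_M T_carrier \<sigma>T u_\<Omega> u_inj \<sigma>_u T_u])
qed

section \<open>The subgroup generated by the base group and the stable letters\<close>

theorem lemma4p2:
  fixes r :: nat and G :: "'a set" and M :: "'a monoid"
    and K :: "nat \<Rightarrow> 'a monoid" and L :: "nat \<Rightarrow> 'a set"
  assumes r: "r \<ge> 1"
    and M: "group M"
    and K: "\<And>i. i \<in> {1..r} \<Longrightarrow> group (K i)"
    and G: "subgroup G M"
    and MK: "\<And>i. i \<in> {1..r} \<Longrightarrow> (\<lambda>x. x) \<in> hom M (K i)"
    and KK: "\<And>i j. i \<in> {1..r} \<Longrightarrow> j \<in> {1..r} \<Longrightarrow> i \<noteq> j \<Longrightarrow> carrier (K i) \<inter> carrier (K j) = carrier M"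
    and L: "\<And>i. i \<in> {1..r} \<Longrightarrow> subgroup (L i) (K i)"
  shows "let H = M\<lparr>carrier := G\<rparr>; A = (\<lambda>i. G \<inter> L i);
             S = star_group K L (carrier M) r;
             e = star_base K L (carrier M) r; t = star_stable K L (carrier M) r
         in \<exists>\<phi> \<in> hom (hnn H {1..r} A) S.
              (\<forall>g\<in>G. \<phi> (hnn_base H {1..r} A g) = e g) \<and>
              (\<forall>i\<in>{1..r}. \<phi> (hnn_stable H {1..r} A i) = t i) \<and>
              inj_on \<phi> (carrier (hnn H {1..r} A)) \<and>
              \<phi> ` carrier (hnn H {1..r} A) = generate S (e ` G \<union> t ` {1..r})"
proof -
  define H where "H = M\<lparr>carrier := G\<rparr>"
  define A where "A i = G \<inter> L i" for i
  define S where "S = star_group K L (carrier M) r"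
  define e where "e = star_base K L (carrier M) r"
  define t where "t = star_stable K L (carrier M) r"
  define E where "E = hnn H {1..r} A"
  define \<beta> where "\<beta> = hnn_base H {1..r} A"
  define s where "s = hnn_stable H {1..r} A"
  define b where "b = (\<lambda>i. hnn_base (K i) {i} L)"
  interpret M: group M by fact
  interpret G: subgroup G M by fact
  have H: "group H" unfolding H_def by (rule G.subgroup_is_group[OF M])
  have carH [simp]: "carrier H = G" by (simp add: H_def)
  interpret E: group E unfolding E_def by (rule hnn_is_group)
  have one: "1 \<in> {1..r}" using r by simp
  have MinK: "m \<in> carrier (K i)" if "i \<in> {1..r}" "m \<in> carrier M" for i m
    using hom_in_carrier[OF MK[OF that(1)] that(2)] .

  obtain S' f where star: "star_system K L (carrier M) r = (S', f)" by fastforce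
  have S': "S' = S" using star by (simp add: S_def star_group_def)
  have iter: "iter_amalg (star_factor K L) (carrier M) b r = (S, f)"
    using star S' by (simp add: star_system_def b_def)
  have e_f: "e m = f 1 (b 1 m)" for m by (simp add: e_def star_base_def star b_def del: One_nat_def)
  have t_f: "t i = f i (hnn_stable (K i) {i} L i)" for i by (simp add: t_def star_stable_def star)
  have factor: "group (star_factor K L i)" for i
    unfolding star_factor_def by (rule hnn_is_group)
  have b_hom: "b i \<in> hom (K i) (star_factor K L i)" if "i \<in> {1..r}" for i
    unfolding star_factor_def b_def by (rule hnn_base_hom[OF K[OF that]])
  have b_M: "b i m \<in> carrier (star_factor K L i)" if "i \<in> {1..r}" "m \<in> carrier M" for i m
    using hom_in_carrier[OF b_hom MinK] that by blast
  have tf: "hnn_stable (K i) {i} L i \<in> carrier (star_factor K L i)" for i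
    unfolding star_factor_def by (rule hnn_stable_closed) simp
  have cocone: "group S \<and> (\<forall>i\<in>{1..r}. f i \<in> hom (star_factor K L i) S \<and>
      (\<forall>m\<in>carrier M. f i (b i m) = f 1 (b 1 m)))"
    by (rule iter_amalg_cocone[OF r factor b_M iter])
  then interpret S: group S by blast
  have f_hom: "f i \<in> hom (star_factor K L i) S" if "i \<in> {1..r}" for i using cocone that by blast
  have f_b: "f i (b i m) = e m" if "i \<in> {1..r}" "m \<in> carrier M" for i m
    using cocone that unfolding e_f by blast
  have e_hom: "e \<in> hom H S"
  proof (rule homI)
    fix x y assume x: "x \<in> carrier H" and y: "y \<in> carrier H"
    have xy: "x \<in> carrier M" "y \<in> carrier M" using x y by simp_all
    have "f 1 \<circ> b 1 \<in> hom (K 1) S" using hom_compose[OF b_hom f_hom] one by blast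
    then have hom: "(f 1 \<circ> b 1) \<circ> (\<lambda>x. x) \<in> hom M S" using hom_compose[OF MK[OF one]] by blast
    show "e x \<in> carrier S" using hom_in_carrier[OF hom xy(1)] by (simp add: e_f)
    show "e (x \<otimes>\<^bsub>H\<^esub> y) = e x \<otimes>\<^bsub>S\<^esub> e y" using hom_mult[OF hom xy] by (simp add: e_f H_def)
  qed
  have t_S: "t i \<in> carrier S" if "i \<in> {1..r}" for i
    using hom_in_carrier[OF f_hom[OF that] tf] by (simp add: t_f)
  have et: "e a \<otimes>\<^bsub>S\<^esub> t i = t i \<otimes>\<^bsub>S\<^esub> e a" if i: "i \<in> {1..r}" and a: "a \<in> A i" for i a
  proof -
    have a: "a \<in> L i" "a \<in> carrier M" using a by (auto simp: A_def)
    have "b i a \<otimes>\<^bsub>star_factor K L i\<^esub> hnn_stable (K i) {i} L i =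
        hnn_stable (K i) {i} L i \<otimes>\<^bsub>star_factor K L i\<^esub> b i a"
      unfolding star_factor_def b_def
      by (intro hnn_stable_commutes K[OF i] a(1) MinK[OF i a(2)]) simp
    then show ?thesis
      using hom_mult[OF f_hom[OF i] b_M[OF i a(2)] tf] hom_mult[OF f_hom[OF i] tf b_M[OF i a(2)]]
      by (simp add: t_f f_b[OF i a(2), symmetric])
  qed
  have "\<exists>\<phi>\<in>hom E S. (\<forall>g\<in>carrier H. \<phi> (\<beta> g) = e g) \<and> (\<forall>i\<in>{1..r}. \<phi> (s i) = t i)"
    unfolding E_def \<beta>_def s_def using t_S et by (intro hnn_hom[OF H S.is_group e_hom]) auto
  then obtain \<phi> where \<phi>: "\<phi> \<in> hom E S" and \<phi>\<beta>: "\<And>g. g \<in> G \<Longrightarrow> \<phi> (\<beta> g) = e g"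
    and \<phi>s: "\<And>i. i \<in> {1..r} \<Longrightarrow> \<phi> (s i) = t i" by auto
  interpret \<phi>: group_hom E S \<phi> by unfold_locales (rule \<phi>)

  have \<beta>: "\<beta> \<in> hom H E" unfolding \<beta>_def E_def by (rule hnn_base_hom[OF H])
  have s: "s i \<in> carrier E" if "i \<in> {1..r}" for i
    unfolding s_def E_def by (rule hnn_stable_closed[OF that])
  have \<beta>s: "\<beta> a \<otimes>\<^bsub>E\<^esub> s i = s i \<otimes>\<^bsub>E\<^esub> \<beta> a" if "i \<in> {1..r}" "a \<in> G" "a \<in> L i" for i a
    unfolding s_def E_def \<beta>_def by (rule hnn_stable_commutes[OF H]) (use that in \<open>auto simp: A_def\<close>)
  have gen: "carrier E = generate E (\<beta> ` G \<union> s ` {1..r})"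
    unfolding s_def E_def \<beta>_def using hnn_generated[of H "{1..r}" A] by simp
  have gens_E: "\<beta> ` G \<union> s ` {1..r} \<subseteq> carrier E"
    using hom_in_carrier[OF \<beta>] s by auto
  have "\<phi> ` carrier E = generate S (\<phi> ` (\<beta> ` G \<union> s ` {1..r}))"
    using \<phi>.generate_img[OF gens_E] gen by simp
  also have "\<phi> ` (\<beta> ` G \<union> s ` {1..r}) = e ` G \<union> t ` {1..r}"
    by (simp only: image_Un image_image \<phi>\<beta> \<phi>s cong: image_cong)
  finally have image: "\<phi> ` carrier E = generate S (e ` G \<union> t ` {1..r})" .

  \<comment> \<open>the retraction onto \<open>G\<close> that kills the stable letters\<close>
  have "\<exists>\<rho>\<in>hom E H. (\<forall>g\<in>carrier H. \<rho> (\<beta> g) = g) \<and> (\<forall>i\<in>{1..r}. \<rho> (s i) = \<one>\<^bsub>H\<^esub>)"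
    unfolding E_def \<beta>_def s_def
    by (rule hnn_hom[OF H H]) (simp_all add: hom_def H_def)
  then obtain \<rho> where \<rho>: "\<rho> \<in> hom E H" "\<And>g. g \<in> G \<Longrightarrow> \<rho> (\<beta> g) = g"
    "\<And>i. i \<in> {1..r} \<Longrightarrow> \<rho> (s i) = \<one>\<^bsub>M\<^esub>" by (auto simp: H_def)

  have "{1..r} \<noteq> {}" using one by blast
  note rep = extension_to_permutations[where K = K and L = L and s = s and \<beta> = \<beta> and \<rho> = \<rho> and G = G,
      OF M K MK G L this E.is_group \<beta>[unfolded H_def] s \<beta>s \<rho>(1)[unfolded H_def] \<rho>(2,3)]
  obtain \<Omega> :: "(('a \<times> (nat \<Rightarrow> 'a)) \<times> ('a + nat) gword set) set" and \<sigma> T u where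
    \<sigma>: "\<And>i. i \<in> {1..r} \<Longrightarrow> \<sigma> i \<in> hom (K i) (BijGroup \<Omega>)"
    and \<sigma>_M: "\<And>i j m. i \<in> {1..r} \<Longrightarrow> j \<in> {1..r} \<Longrightarrow> m \<in> carrier M \<Longrightarrow> \<sigma> i m = \<sigma> j m"
    and T: "\<And>i. i \<in> {1..r} \<Longrightarrow> T i \<in> carrier (BijGroup \<Omega>)"
    and \<sigma>T: "\<And>i l. i \<in> {1..r} \<Longrightarrow> l \<in> L i \<Longrightarrow>
      \<sigma> i l \<otimes>\<^bsub>BijGroup \<Omega>\<^esub> T i = T i \<otimes>\<^bsub>BijGroup \<Omega>\<^esub> \<sigma> i l"
    and u: "u ` carrier E \<subseteq> \<Omega>" "inj_on u (carrier E)"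
    and \<sigma>_u: "\<And>i g x. i \<in> {1..r} \<Longrightarrow> g \<in> G \<Longrightarrow> x \<in> carrier E \<Longrightarrow> \<sigma> i g (u x) = u (\<beta> g \<otimes>\<^bsub>E\<^esub> x)"
    and T_u: "\<And>i x. i \<in> {1..r} \<Longrightarrow> x \<in> carrier E \<Longrightarrow> T i (u x) = u (s i \<otimes>\<^bsub>E\<^esub> x)"
    by (rule rep) blast+
  interpret B: group "BijGroup \<Omega>" by (rule group_BijGroup)

  \<comment> \<open>The permutations assemble to representations of the factors, and these to one of the whole construction.\<close>
  have "\<forall>i\<in>{1..r}. \<exists>\<theta>. \<theta> \<in> hom (star_factor K L i) (BijGroup \<Omega>) \<and>
      (\<forall>a\<in>carrier (K i). \<theta> (b i a) = \<sigma> i a) \<and> \<theta> (hnn_stable (K i) {i} L i) = T i"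
  proof
    fix i assume i: "i \<in> {1..r}"
    have "\<exists>\<theta>\<in>hom (hnn (K i) {i} L) (BijGroup \<Omega>).
        (\<forall>a\<in>carrier (K i). \<theta> (hnn_base (K i) {i} L a) = \<sigma> i a) \<and>
        (\<forall>j\<in>{i}. \<theta> (hnn_stable (K i) {i} L j) = T j)"
      by (rule hnn_hom[OF K[OF i] B.is_group]) (use \<sigma> T \<sigma>T i in auto)
    then show "\<exists>\<theta>. \<theta> \<in> hom (star_factor K L i) (BijGroup \<Omega>) \<and>
        (\<forall>a\<in>carrier (K i). \<theta> (b i a) = \<sigma> i a) \<and> \<theta> (hnn_stable (K i) {i} L i) = T i"
      unfolding star_factor_def b_def by blast
  qed
  from bchoice[OF this] obtain \<theta> where \<theta>: "\<forall>i\<in>{1..r}. \<theta> i \<in> hom (star_factor K L i) (BijGroup \<Omega>) \<and>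
      (\<forall>a\<in>carrier (K i). \<theta> i (b i a) = \<sigma> i a) \<and> \<theta> i (hnn_stable (K i) {i} L i) = T i"
    by blast
  have \<theta>_hom: "\<theta> i \<in> hom (star_factor K L i) (BijGroup \<Omega>)" if "i \<in> {1..r}" for i
    using \<theta> that by blast
  have \<theta>_M: "\<theta> i (b i m) = \<theta> 1 (b 1 m)" if i: "i \<in> {1..r}" and m: "m \<in> carrier M" for i m
  proof -
    have "\<theta> i (b i m) = \<sigma> i m" "\<theta> 1 (b 1 m) = \<sigma> 1 m"
      using \<theta> i one m MinK by blast+
    moreover have "\<sigma> i m = \<sigma> 1 m" by (rule \<sigma>_M[OF i one m])
    ultimately show ?thesis by simp
  qed
  have "\<exists>\<Theta>\<in>hom S (BijGroup \<Omega>). \<forall>i\<in>{1..r}. \<forall>h\<in>carrier (star_factor K L i). \<Theta> (f i h) = \<theta> i h"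
    by (rule iter_amalg_hom[OF r factor b_M iter B.is_group \<theta>_hom \<theta>_M])
  then obtain \<Theta> where \<Theta>: "\<Theta> \<in> hom S (BijGroup \<Omega>)"
    and \<Theta>f: "\<forall>i\<in>{1..r}. \<forall>h\<in>carrier (star_factor K L i). \<Theta> (f i h) = \<theta> i h" by blast
  define \<Phi> where "\<Phi> = \<Theta> \<circ> \<phi>"
  have \<Phi>: "\<Phi> \<in> hom E (BijGroup \<Omega>)" unfolding \<Phi>_def by (rule hom_compose[OF \<phi> \<Theta>])
  have \<Phi>\<beta>: "\<Phi> (\<beta> g) = \<sigma> 1 g" if g: "g \<in> G" for g
  proof -
    have gM: "g \<in> carrier M" using g by simp
    have "\<Phi> (\<beta> g) = \<Theta> (f 1 (b 1 g))" using \<phi>\<beta>[OF g] by (simp only: \<Phi>_def e_f comp_apply)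
    also have "\<dots> = \<theta> 1 (b 1 g)" using \<Theta>f one b_M[OF one gM] by blast
    also have "\<dots> = \<sigma> 1 g" using \<theta> one MinK[OF one gM] by blast
    finally show ?thesis .
  qed
  have \<Phi>s: "\<Phi> (s i) = T i" if i: "i \<in> {1..r}" for i
  proof -
    have "\<Phi> (s i) = \<Theta> (f i (hnn_stable (K i) {i} L i))" using \<phi>s[OF i] by (simp add: \<Phi>_def t_f)
    also have "\<dots> = \<theta> i (hnn_stable (K i) {i} L i)" using \<Theta>f i tf by blast
    also have "\<dots> = T i" using \<theta> i by blast
    finally show ?thesis .
  qed
  have gens_u: "\<Phi> h (u x) = u (h \<otimes>\<^bsub>E\<^esub> x)" if "h \<in> \<beta> ` G \<union> s ` {1..r}" "x \<in> carrier E" for h x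
    using that \<sigma>_u[OF one] T_u \<Phi>\<beta> \<Phi>s by auto
  have \<Phi>_u: "\<Phi> y (u x) = u (y \<otimes>\<^bsub>E\<^esub> x)" if "y \<in> carrier E" "x \<in> carrier E" for y x
    by (rule E.translations_from_generators[OF \<Phi> gens_E gen u(1) gens_u that])
  \<comment> \<open>The permutation of \<open>\<Omega>\<close> that \<open>\<phi> x\<close> induces sends \<open>u 1\<close> to \<open>u x\<close>, so \<open>\<phi> x\<close> determines \<open>x\<close>.\<close>
  have "inj_on \<phi> (carrier E)"
  proof (rule inj_onI)
    fix x y assume x: "x \<in> carrier E" and y: "y \<in> carrier E" and "\<phi> x = \<phi> y"
    then have "\<Phi> x (u \<one>\<^bsub>E\<^esub>) = \<Phi> y (u \<one>\<^bsub>E\<^esub>)" by (simp add: \<Phi>_def)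
    then have "u x = u y" using x y by (simp add: \<Phi>_u)
    then show "x = y" using u(2) x y by (simp add: inj_on_eq_iff)
  qed
  then have "\<exists>\<phi>\<in>hom E S. (\<forall>g\<in>G. \<phi> (\<beta> g) = e g) \<and> (\<forall>i\<in>{1..r}. \<phi> (s i) = t i) \<and>
      inj_on \<phi> (carrier E) \<and> \<phi> ` carrier E = generate S (e ` G \<union> t ` {1..r})"
    using \<phi> \<phi>\<beta> \<phi>s image by blast
  moreover have "(\<lambda>i. G \<inter> L i) = A" by (simp add: A_def fun_eq_iff)
  ultimately show ?thesis
    unfolding Let_def by (simp only: E_def \<beta>_def s_def S_def e_def t_def H_def)
qed

end
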